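(* Let $s$ be an integer such that $3s^2-4s+4$ is a perfect square. Let $K_s$ be the splitting field over $\mathbb{Q}$ of $$F_s(t)= t^4 + (4s^3 - 4s^2 + 8s - 4)t^3 + (-6s^2 - 6)t^2 + 4t + 1.$$ Then $\mathrm{Gal}(K_s/\mathbb{Q})$ is cyclic of order 4. Moreover, if $s^2+2$ is squarefree and $s\neq 0$, then $\pm 1$ together with the four roots of $F_s(t)$ generate either the full unit group of the ring of algebraic integers of $K_s$, or a subgroup of index $5$ in it. *)

theory Defs
  imports Complex_Main "HOL-Computational_Algebra.Computational_Algebra"
begin

definition F_poly :: "int \<Rightarrow> complex poly" where
  "F_poly s = map_poly of_int
     [:1, 4, -6*s^2 - 6, 4*s^3 - 4*s^2 + 8*s - 4, 1:]"

definition F_roots :: "int \<Rightarrow> complex set" where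
  "F_roots s = {z. poly (F_poly s) z = 0}"

definition is_subfield :: "complex set \<Rightarrow> bool" where
  "is_subfield L \<longleftrightarrow> 0 \<in> L \<and> 1 \<in> L \<and>
     (\<forall>x\<in>L. \<forall>y\<in>L. x + y \<in> L \<and> x * y \<in> L) \<and>
     (\<forall>x\<in>L. - x \<in> L) \<and> (\<forall>x\<in>L. x \<noteq> 0 \<longrightarrow> inverse x \<in> L)"

definition splitting_field :: "complex poly \<Rightarrow> complex set" where
  "splitting_field p = \<Inter>{L. is_subfield L \<and> {z. poly p z = 0} \<subseteq> L}"

definition galois_group :: "complex set \<Rightarrow> (complex \<Rightarrow> complex) set" where
  "galois_group K = {\<sigma>. bij_betw \<sigma> K K \<and>
      (\<forall>x\<in>K. \<forall>y\<in>K. \<sigma> (x + y) = \<sigma> x + \<sigma> y \<and> \<sigma> (x * y) = \<sigma> x * \<sigma> y) \<and>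
      (\<forall>q\<in>\<rat>. \<sigma> q = q) \<and> (\<forall>x. x \<notin> K \<longrightarrow> \<sigma> x = x)}"

definition cyclic_of_order :: "nat \<Rightarrow> ('a \<Rightarrow> 'a) set \<Rightarrow> bool" where
  "cyclic_of_order n G \<longleftrightarrow> card G = n \<and> (\<exists>\<sigma>\<in>G. \<forall>\<tau>\<in>G. \<exists>k. \<tau> = \<sigma> ^^ k)"

definition algebraic_integer :: "complex \<Rightarrow> bool" where
  "algebraic_integer x \<longleftrightarrow> (\<exists>p :: int poly. lead_coeff p = 1 \<and> poly (map_poly of_int p) x = 0)"

definition ring_of_integers :: "complex set \<Rightarrow> complex set" where
  "ring_of_integers K = {x \<in> K. algebraic_integer x}"

definition unit_group :: "complex set \<Rightarrow> complex set" where
  "unit_group K = {u \<in> ring_of_integers K. u \<noteq> 0 \<and> inverse u \<in> ring_of_integers K}"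

inductive_set mult_subgroup_gen :: "complex set \<Rightarrow> complex set" for S where
  one: "1 \<in> mult_subgroup_gen S"
| gen: "x \<in> S \<Longrightarrow> x \<in> mult_subgroup_gen S"
| inv: "x \<in> S \<Longrightarrow> inverse x \<in> mult_subgroup_gen S"
| mult: "x \<in> mult_subgroup_gen S \<Longrightarrow> y \<in> mult_subgroup_gen S \<Longrightarrow> x * y \<in> mult_subgroup_gen S"

definition subgroup_index :: "complex set \<Rightarrow> complex set \<Rightarrow> nat" where
  "subgroup_index U H = card ((\<lambda>u. (\<lambda>h. u * h) ` H) ` U)"

end

theory Submission
  imports Defs "Jordan_Normal_Form.Char_Poly"
begin

text \<open>
  Put \<open>d = s\<^sup>2 + 2\<close>, \<open>w = \<surd>d\<close>, and let \<open>\<epsilon>, \<sigma>\<epsilon>, \<sigma>\<^sup>2\<epsilon>, \<sigma>\<^sup>3\<epsilon>\<close> be the roots. Over \<open>\<rat>(w)\<close> the polynomial splits into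
  two quadratics whose discriminants have product \<open>16 d m\<^sup>2\<close>, which makes the field cyclic.
  The relative norm \<open>\<nu> = \<epsilon> \<sigma>\<^sup>2\<epsilon> = -(s\<^sup>2 + 1 + s w)\<close> is, up to sign, the fundamental unit of \<open>\<int>[w]\<close> or its inverse, so every
  unit is a power of \<open>\<epsilon>\<close> times a relative unit, that is, a unit \<open>u\<close> with \<open>u \<sigma>\<^sup>2u = \<plusminus>1\<close>. Modulo \<open>\<plusminus>1\<close> the relative units
  form a module over \<open>\<int>[\<i>]\<close>, with \<open>\<sigma>\<close> acting as a primitive fourth root of unity.

  If \<open>u \<noteq> \<plusminus>1\<close> is a relative unit, then \<open>u + \<sigma>\<^sup>2u = P + Q w\<close> with \<open>Q\<close> even and nonzero, whence
  \<open>(ln \<bar>u\<bar>)\<^sup>2 + (ln \<bar>\<sigma>u\<bar>)\<^sup>2 > (ln \<bar>2 s\<bar>)\<^sup>2\<close>. So the module is generated by a single \<open>\<mu>\<close>, and for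
  \<open>\<rho> = \<epsilon> \<sigma>\<epsilon>\<close>, which generates the relative units in \<open>H\<close>, the identity \<open>\<rho> + \<sigma>\<^sup>2\<rho> = -2 (s\<^sup>2 + 1) + 2 m w\<close> shows that
  \<open>\<rho> = \<alpha> \<mu>\<close> (written additively) with \<open>\<alpha> \<in> \<int>[\<i>]\<close> of norm less than 9. The index is this norm. It is odd, since a factor \<open>1 + \<i>\<close> of \<open>\<alpha>\<close> would make
  \<open>\<nu>\<close> a square up to sign. The odd norms below 9 are 1 and 5.
\<close>

section \<open>Algebraic integers\<close>

definition int_span :: "complex set \<Rightarrow> complex set" where
  "int_span V = {\<Sum>v\<in>V. of_int (c v) * v |c. True}"

lemma int_span_add: "x \<in> int_span V \<Longrightarrow> y \<in> int_span V \<Longrightarrow> x + y \<in> int_span V"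
  unfolding int_span_def
proof clarify
  fix c c' :: "complex \<Rightarrow> int"
  show "\<exists>c''. (\<Sum>v\<in>V. of_int (c v) * v) + (\<Sum>v\<in>V. of_int (c' v) * v) = (\<Sum>v\<in>V. of_int (c'' v) * v) \<and> True"
    by (rule exI[of _ "\<lambda>v. c v + c' v"]) (simp add: sum.distrib algebra_simps)
qed

lemma int_span_smult: "x \<in> int_span V \<Longrightarrow> of_int k * x \<in> int_span V"
  unfolding int_span_def
proof clarify
  fix c :: "complex \<Rightarrow> int"
  show "\<exists>c''. of_int k * (\<Sum>v\<in>V. of_int (c v) * v) = (\<Sum>v\<in>V. of_int (c'' v) * v) \<and> True"
    by (rule exI[of _ "\<lambda>v. k * c v"]) (simp add: sum_distrib_left algebra_simps)
qed

lemma int_span_0: "0 \<in> int_span V"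
  unfolding int_span_def by (auto intro!: exI[of _ "\<lambda>_. 0"])

lemma int_span_sum: "(\<And>i. i \<in> I \<Longrightarrow> g i \<in> int_span V) \<Longrightarrow> sum g I \<in> int_span V"
  by (induction I rule: infinite_finite_induct) (auto intro: int_span_0 int_span_add)

lemma int_span_base: "finite V \<Longrightarrow> v \<in> V \<Longrightarrow> v \<in> int_span V"
  unfolding int_span_def
  by (auto intro!: exI[of _ "\<lambda>x. if x = v then 1 else 0"] simp: if_distrib[of of_int] if_distrib[of "\<lambda>x. x * _"] cong: if_cong)

lemma int_span_mult_closed:
  assumes "\<And>v. v \<in> V \<Longrightarrow> z * v \<in> int_span V" "x \<in> int_span V"
  shows "z * x \<in> int_span V"
proof -
  obtain c where x: "x = (\<Sum>v\<in>V. of_int (c v) * v)"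
    using assms(2) unfolding int_span_def by auto
  have "z * x = (\<Sum>v\<in>V. of_int (c v) * (z * v))"
    by (simp add: x sum_distrib_left algebra_simps)
  thus ?thesis by (auto intro!: int_span_sum int_span_smult assms)
qed

text \<open>The determinant trick: multiplication by \<open>z\<close> is described by an integer
  matrix, the elements of \<open>V\<close> form an eigenvector for the eigenvalue \<open>z\<close>,
  and the characteristic polynomial is monic and integral. The element \<open>v0\<close> keeps the
  eigenvector from being zero.\<close>

lemma algebraic_integer_of_stable_span:
  assumes "finite V" "v0 \<in> V" "v0 \<noteq> 0" and stable: "\<And>v. v \<in> V \<Longrightarrow> z * v \<in> int_span V"
  shows "algebraic_integer z"
proof -
  define N where "N = card V"
  obtain h where h: "bij_betw h {..<N} V"
    using ex_bij_betw_nat_finite[OF \<open>finite V\<close>] unfolding N_def atLeast0LessThan by auto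
  have "\<forall>v\<in>V. \<exists>c. z * v = (\<Sum>u\<in>V. of_int (c u) * u)"
    using stable unfolding int_span_def by auto
  then obtain C where C: "\<And>v. v \<in> V \<Longrightarrow> z * v = (\<Sum>u\<in>V. of_int (C v u) * u)"
    by metis
  define A :: "int mat" where "A = mat N N (\<lambda>(i,j). C (h i) (h j))"
  define A' :: "complex mat" where "A' = map_mat of_int A"
  have A: "A \<in> carrier_mat N N" and A': "A' \<in> carrier_mat N N"
    by (auto simp: A_def A'_def)
  define x where "x = vec N h"
  have hV: "h i \<in> V" if "i < N" for i using h that by (auto simp: bij_betw_def)
  have "A' *\<^sub>v x = z \<cdot>\<^sub>v x"
  proof (rule eq_vecI)
    fix i assume "i < dim_vec (z \<cdot>\<^sub>v x)"
    hence i: "i < N" by (simp add: x_def)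
    have "(A' *\<^sub>v x) $ i = (\<Sum>j<N. of_int (C (h i) (h j)) * h j)"
      using i by (simp add: A'_def A_def x_def scalar_prod_def atLeast0LessThan)
    also have "\<dots> = (\<Sum>u\<in>V. of_int (C (h i) u) * u)"
      by (rule sum.reindex_bij_betw[OF h])
    also have "\<dots> = z * h i" using C[OF hV[OF i]] by simp
    finally show "(A' *\<^sub>v x) $ i = (z \<cdot>\<^sub>v x) $ i" using i by (simp add: x_def)
  qed (use A' in \<open>simp add: x_def\<close>)
  moreover obtain i where "i < N" "h i = v0"
    using h \<open>v0 \<in> V\<close> by (auto simp: bij_betw_def image_iff)
  hence "x \<noteq> 0\<^sub>v N" using \<open>v0 \<noteq> 0\<close> by (auto simp: x_def vec_eq_iff)
  ultimately have "eigenvalue A' z"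
    unfolding eigenvalue_def eigenvector_def using A' by (intro exI[of _ x]) (auto simp: x_def)
  hence "poly (char_poly A') z = 0" using eigenvalue_root_char_poly[OF A'] by simp
  hence "poly (map_poly of_int (char_poly A)) z = 0"
    unfolding A'_def of_int_hom.char_poly_hom[OF A] .
  moreover have "lead_coeff (char_poly A) = 1"
    using degree_monic_char_poly[OF A] by simp
  ultimately show ?thesis unfolding algebraic_integer_def by blast
qed

text \<open>Reducing powers by the monic equations of \<open>x\<close> and \<open>y\<close> shows
  that the monomials x^i y^j with i < n and j < m span a module stable under \<open>x\<close> and
  \<open>y\<close>, hence under their sum and product.\<close>

lemma algebraic_integer_add_mult:
  assumes "algebraic_integer x" "algebraic_integer y"
  shows "algebraic_integer (x + y)" "algebraic_integer (x * y)"
proof -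
  have red: "\<exists>n c. n > 0 \<and> x ^ n = (\<Sum>l<n. of_int (c l) * x ^ l)" if x: "algebraic_integer x" for x
  proof -
    obtain p :: "int poly" where p: "lead_coeff p = 1" "poly (map_poly of_int p) x = 0"
      using x unfolding algebraic_integer_def by auto
    have 0: "(\<Sum>l\<le>degree p. of_int (coeff p l) * x ^ l) = 0"
      using p(2) by (simp add: poly_altdef coeff_map_poly degree_map_poly)
    \<comment> \<open>A monic constant has no root. Positive degrees put 1 = x^0 y^0 into
      \<open>V\<close>, which supplies the nonzero element.\<close>
    have "degree p \<noteq> 0"
    proof
      assume "degree p = 0"
      thus False using 0 p(1) by simp
    qed
    moreover have "x ^ degree p = (\<Sum>l<degree p. of_int (- coeff p l) * x ^ l)"
      using 0 p(1) by (simp add: lessThan_Suc_atMost[symmetric] sum_negf add_eq_0_iff)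
    ultimately show ?thesis by (metis neq0_conv)
  qed
  obtain n c where n: "n > 0" "x ^ n = (\<Sum>l<n. of_int (c l) * x ^ l)" using red[OF assms(1)] by metis
  obtain m b where m: "m > 0" "y ^ m = (\<Sum>l<m. of_int (b l) * y ^ l)" using red[OF assms(2)] by metis
  define V where "V = (\<lambda>(i,j). x ^ i * y ^ j) ` ({..<n} \<times> {..<m})"
  have fin: "finite V" unfolding V_def by simp
  have mem: "x ^ i * y ^ j \<in> V" if "i < n" "j < m" for i j using that unfolding V_def by auto
  have one: "1 \<in> V" using mem[of 0 0] n m by simp
  have x: "x * v \<in> int_span V" if vV: "v \<in> V" for v
  proof -
    obtain i j where v: "v = x ^ i * y ^ j" "i < n" "j < m" using vV unfolding V_def by auto
    show ?thesis
    proof (cases "Suc i < n")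
      case True
      thus ?thesis using int_span_base[OF fin mem[of "Suc i" j]] v by (simp add: mult.assoc)
    next
      case False
      hence "n = Suc i" using v by simp
      hence "x * v = x ^ n * y ^ j" using v by simp
      also have "\<dots> = (\<Sum>l<n. of_int (c l) * (x ^ l * y ^ j))"
        by (simp add: n(2) sum_distrib_right mult.assoc)
      also have "\<dots> \<in> int_span V"
        using v by (intro int_span_sum int_span_smult int_span_base fin mem) auto
      finally show ?thesis .
    qed
  qed
  have y: "y * v \<in> int_span V" if vV: "v \<in> V" for v
  proof -
    obtain i j where v: "v = x ^ i * y ^ j" "i < n" "j < m" using vV unfolding V_def by auto
    show ?thesis
    proof (cases "Suc j < m")
      case True
      thus ?thesis using int_span_base[OF fin mem[of i "Suc j"]] v by (simp add: mult_ac)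
    next
      case False
      hence "m = Suc j" using v by simp
      hence "y * v = x ^ i * y ^ m" using v by simp
      also have "\<dots> = (\<Sum>l<m. of_int (b l) * (x ^ i * y ^ l))"
        by (simp add: m(2) sum_distrib_left mult_ac)
      also have "\<dots> \<in> int_span V"
        using v by (intro int_span_sum int_span_smult int_span_base fin mem) auto
      finally show ?thesis .
    qed
  qed
  show "algebraic_integer (x + y)"
    by (rule algebraic_integer_of_stable_span[OF fin one]) (auto simp: distrib_right intro: int_span_add x y)
  show "algebraic_integer (x * y)"
    by (rule algebraic_integer_of_stable_span[OF fin one])
      (auto simp: mult.assoc intro!: int_span_mult_closed[OF x] y)
qed

lemma algebraic_integer_iff_algebraic_int: "algebraic_integer x \<longleftrightarrow> algebraic_int x"
  by (auto simp: algebraic_integer_def algebraic_int_altdef_ipoly)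

lemma algebraic_integer_of_int: "algebraic_integer (of_int k)"
  by (simp add: algebraic_integer_iff_algebraic_int int_imp_algebraic_int)

lemma algebraic_integer_minus: "algebraic_integer x \<Longrightarrow> algebraic_integer (- x)"
  by (simp add: algebraic_integer_iff_algebraic_int)

lemma algebraic_integer_diff:
  "algebraic_integer x \<Longrightarrow> algebraic_integer y \<Longrightarrow> algebraic_integer (x - y)"
  using algebraic_integer_add_mult(1)[OF _ algebraic_integer_minus, of x y] by simp

lemma algebraic_integer_of_rat:
  assumes "algebraic_integer (of_rat q)"
  obtains k :: int where "q = of_int k"
proof -
  have "of_rat q \<in> (\<int> :: complex set)"
    using assms by (intro rational_algebraic_int_is_int) (auto simp: algebraic_integer_iff_algebraic_int)
  then obtain k where "of_rat q = (of_int k :: complex)" by (auto elim: Ints_cases)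
  hence "of_rat q = (of_rat (of_int k) :: complex)" by simp
  thus ?thesis using that by (metis of_rat_eq_iff)
qed

section \<open>Cyclic quartic fields\<close>

lemma subfield_of_rat:
  assumes "is_subfield L"
  shows "of_rat q \<in> L"
proof -
  have 01: "0 \<in> L" "1 \<in> L" and add: "\<And>x y. x \<in> L \<Longrightarrow> y \<in> L \<Longrightarrow> x + y \<in> L"
    and mult: "\<And>x y. x \<in> L \<Longrightarrow> y \<in> L \<Longrightarrow> x * y \<in> L"
    and minus: "\<And>x. x \<in> L \<Longrightarrow> - x \<in> L" and inv: "\<And>x. x \<in> L \<Longrightarrow> inverse x \<in> L"
    using assms unfolding is_subfield_def by (metis inverse_zero)+
  have nat: "of_nat n \<in> L" for n by (induction n) (auto intro: 01 add)
  have int: "of_int n \<in> L" for n by (cases n) (auto simp del: of_nat_Suc intro: nat minus)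
  show ?thesis
  proof (cases q)
    case (Fract x y)
    hence "of_rat q = of_int x * inverse (of_int y :: complex)"
      by (simp add: of_rat_rat divide_inverse)
    thus ?thesis by (auto intro: mult inv int)
  qed
qed

text \<open>The classical normal form Q(sqrt(c (d + b sqrt d))), d = a^2 + b^2, of a cyclic quartic
  field. Here \<open>w\<close> is a square root of \<open>d\<close>, and \<open>e\<close>,
  \<open>f\<close> are square roots of the two conjugate radicands, with signs tied together by
  \<open>ef\<close>. The six products are the multiplication table of the basis 1, \<open>w\<close>,
  \<open>e\<close>, \<open>f\<close>.\<close>

locale cyclic_quartic =
  fixes a b c d :: rat and w e f :: complex
  assumes ww: "w * w = of_rat d"
    and ee: "e * e = of_rat c * (of_rat d + of_rat b * w)"
    and ff: "f * f = of_rat c * (of_rat d - of_rat b * w)"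
    and ef: "e * f = of_rat c * of_rat a * w"
    and we: "w * e = of_rat a * f + of_rat b * e"
    and wf: "w * f = of_rat a * e - of_rat b * f"
    and abd: "a\<^sup>2 + b\<^sup>2 = d"
    and a0: "a \<noteq> 0" and c0: "c \<noteq> 0"
    and nonsquare: "q\<^sup>2 \<noteq> d"
begin

section \<open>Arithmetic in the basis 1, w, e, f\<close>

definition elt :: "rat \<Rightarrow> rat \<Rightarrow> rat \<Rightarrow> rat \<Rightarrow> complex" where
  "elt x0 x1 x2 x3 = of_rat x0 + of_rat x1 * w + of_rat x2 * e + of_rat x3 * f"

definition K :: "complex set" where
  "K = {elt x0 x1 x2 x3 |x0 x1 x2 x3. True}"

lemma elt_in_K [simp, intro]: "elt x0 x1 x2 x3 \<in> K"
  unfolding K_def by blast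

lemma K_cases:
  assumes "x \<in> K"
  obtains x0 x1 x2 x3 where "x = elt x0 x1 x2 x3"
  using assms unfolding K_def by blast

lemma elt_add: "elt x0 x1 x2 x3 + elt y0 y1 y2 y3 = elt (x0+y0) (x1+y1) (x2+y2) (x3+y3)"
  unfolding elt_def by (simp add: of_rat_add algebra_simps)

lemma elt_minus: "- elt x0 x1 x2 x3 = elt (-x0) (-x1) (-x2) (-x3)"
  unfolding elt_def by (simp add: of_rat_minus)

lemma elt_diff: "elt x0 x1 x2 x3 - elt y0 y1 y2 y3 = elt (x0-y0) (x1-y1) (x2-y2) (x3-y3)"
  unfolding elt_def by (simp add: of_rat_diff algebra_simps)

lemma elt_mult:
  "elt x0 x1 x2 x3 * elt y0 y1 y2 y3 =
     elt (x0*y0 + d*x1*y1 + c*d*(x2*y2 + x3*y3))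
         (x0*y1 + x1*y0 + c*b*(x2*y2 - x3*y3) + c*a*(x2*y3 + x3*y2))
         (x0*y2 + x2*y0 + b*(x1*y2 + x2*y1) + a*(x1*y3 + x3*y1))
         (x0*y3 + x3*y0 + a*(x1*y2 + x2*y1) - b*(x1*y3 + x3*y1))"
proof -
  have "(X0 + X1 * w + X2 * e + X3 * f) * (Y0 + Y1 * w + Y2 * e + Y3 * f) =
      X0*Y0 + (X0*Y1 + X1*Y0)*w + (X0*Y2+X2*Y0)*e + (X0*Y3+X3*Y0)*f
      + X1*Y1*(w*w) + X2*Y2*(e*e) + X3*Y3*(f*f) + (X2*Y3+X3*Y2)*(e*f)
      + (X1*Y2 + X2*Y1)*(w*e) + (X1*Y3+X3*Y1)*(w*f)"
    for X0 X1 X2 X3 Y0 Y1 Y2 Y3 :: complex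
    by (simp add: algebra_simps)
  note this[of "of_rat x0" "of_rat x1" "of_rat x2" "of_rat x3" "of_rat y0" "of_rat y1" "of_rat y2" "of_rat y3"]
  thus ?thesis
    unfolding elt_def ww ee ff ef we wf
    by (simp add: of_rat_add of_rat_mult of_rat_diff algebra_simps)
qed

lemma d0: "d \<noteq> 0" using nonsquare[of 0] by auto

lemma nonsquare': "x\<^sup>2 = d * y\<^sup>2 \<longleftrightarrow> x = 0 \<and> y = 0"
proof
  assume *: "x\<^sup>2 = d * y\<^sup>2"
  have "y = 0"
  proof (rule ccontr)
    assume "y \<noteq> 0"
    hence "(x / y)\<^sup>2 = d" using * by (simp add: power_divide)
    thus False using nonsquare by blast
  qed
  thus "x = 0 \<and> y = 0" using * by simp
qed auto

lemma elt_0_lin: "elt x y 0 0 = 0 \<Longrightarrow> x = 0 \<and> y = 0"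
proof -
  assume "elt x y 0 0 = 0"
  hence "of_rat x = - of_rat y * w" by (simp add: elt_def add_eq_0_iff)
  hence "of_rat x * of_rat x = of_rat y * of_rat y * (w * w)" by simp
  hence "(of_rat (x * x) :: complex) = of_rat (d * y * y)"
    by (simp add: ww of_rat_mult mult_ac)
  hence "x\<^sup>2 = d * y\<^sup>2" unfolding of_rat_eq_iff by (simp add: power2_eq_square)
  thus ?thesis using nonsquare' by blast
qed

text \<open>If \<open>x\<^sub>0 + x\<^sub>1 w = - (x\<^sub>2 e + x\<^sub>3 f)\<close>, compare the norms down to the rationals of the squares of both sides.\<close>
lemma elt_eq_0_iff: "elt x0 x1 x2 x3 = 0 \<longleftrightarrow> x0 = 0 \<and> x1 = 0 \<and> x2 = 0 \<and> x3 = 0"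
proof
  assume "elt x0 x1 x2 x3 = 0"
  hence "elt x0 x1 0 0 = - elt 0 0 x2 x3" by (simp add: elt_def eq_neg_iff_add_eq_0 algebra_simps)
  hence "elt x0 x1 0 0 * elt x0 x1 0 0 = elt 0 0 x2 x3 * elt 0 0 x2 x3" by simp
  hence "elt x0 x1 0 0 * elt x0 x1 0 0 - elt 0 0 x2 x3 * elt 0 0 x2 x3 = 0" by simp
  hence "elt (x0*x0 + d*x1*x1 - c*d*(x2*x2+x3*x3)) (2*x0*x1 - c*(b*(x2*x2-x3*x3) + 2*a*x2*x3)) 0 0 = 0"
    by (simp add: elt_mult elt_diff algebra_simps)
  from elt_0_lin[OF this]
  have 1: "x0*x0 + d*x1*x1 = c*d*(x2*x2+x3*x3)" and
    2: "2*x0*x1 = c*(b*(x2*x2-x3*x3) + 2*a*x2*x3)" by auto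
  have "(x0\<^sup>2 - d*x1\<^sup>2)\<^sup>2 = (x0*x0 + d*x1*x1)\<^sup>2 - d * (2*x0*x1)\<^sup>2"
    by (simp add: power2_eq_square algebra_simps)
  \<comment> \<open>With X = x2^2 - x3^2 and Y = 2 x2 x3, the identity (a^2 + b^2)(X^2 + Y^2) = (bX
    + aY)^2 + (aX - bY)^2 leaves \<open>d\<close> times a square, so both sides vanish because
    \<open>d\<close> is not a square.\<close>
  also have "\<dots> = d * (c*(a*(x2\<^sup>2 - x3\<^sup>2) - 2*b*x2*x3))\<^sup>2"
    unfolding 1 2 by (simp add: power2_eq_square algebra_simps flip: abd)
  finally have "x0\<^sup>2 - d*x1\<^sup>2 = 0" unfolding nonsquare' by blast
  hence "x0\<^sup>2 = d * x1\<^sup>2" by simp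
  hence x01: "x0 = 0 \<and> x1 = 0" unfolding nonsquare' .
  hence "x2*x2+x3*x3 = 0" using 1 c0 d0 by simp
  thus "x0 = 0 \<and> x1 = 0 \<and> x2 = 0 \<and> x3 = 0"
    using x01 by (simp add: sum_squares_eq_zero_iff)
qed (simp add: elt_def)

lemma elt_inject: "elt x0 x1 x2 x3 = elt y0 y1 y2 y3 \<longleftrightarrow> x0 = y0 \<and> x1 = y1 \<and> x2 = y2 \<and> x3 = y3"
  using elt_eq_0_iff[of "x0-y0" "x1-y1" "x2-y2" "x3-y3"] by (simp flip: elt_diff)

text \<open>The substitution of \<open>- w\<close>, \<open>f\<close>, \<open>- e\<close> for
  \<open>w\<close>, \<open>e\<close>, \<open>f\<close>, which preserves the multiplication table.
  Outside \<open>K\<close> it is the identity because \<open>galois_group\<close> asks for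
  that.\<close>

definition sg :: "complex \<Rightarrow> complex" where
  "sg z = (if z \<in> K then THE v. \<exists>x0 x1 x2 x3. z = elt x0 x1 x2 x3 \<and> v = elt x0 (-x1) (-x3) x2 else z)"

lemma sg_elt [simp]: "sg (elt x0 x1 x2 x3) = elt x0 (-x1) (-x3) x2"
  unfolding sg_def by (auto simp: elt_inject)

lemma sg_notin: "z \<notin> K \<Longrightarrow> sg z = z"
  unfolding sg_def by simp

lemma rat_elt: "of_rat q = elt q 0 0 0"
  by (simp add: elt_def)

lemma one_elt: "1 = elt 1 0 0 0" and zero_elt: "0 = elt 0 0 0 0"
  by (simp_all add: elt_def)

lemma of_int_elt: "of_int n = elt (of_int n) 0 0 0"
  by (simp add: elt_def)

lemma K_add: "x \<in> K \<Longrightarrow> y \<in> K \<Longrightarrow> x + y \<in> K"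
  by (elim K_cases) (simp add: elt_add)

lemma K_minus: "x \<in> K \<Longrightarrow> - x \<in> K"
  by (elim K_cases) (simp add: elt_minus)

lemma K_diff: "x \<in> K \<Longrightarrow> y \<in> K \<Longrightarrow> x - y \<in> K"
  by (elim K_cases) (simp add: elt_diff)

lemma K_mult: "x \<in> K \<Longrightarrow> y \<in> K \<Longrightarrow> x * y \<in> K"
  by (elim K_cases) (simp add: elt_mult)

lemma K_of_rat: "of_rat q \<in> K" and K_of_int: "of_int n \<in> K" and K_0: "0 \<in> K" and K_1: "1 \<in> K"
  by (simp_all add: rat_elt of_int_elt one_elt zero_elt)

lemma sg_K: "x \<in> K \<Longrightarrow> sg x \<in> K"
  by (elim K_cases) simp

lemma sg_add: "x \<in> K \<Longrightarrow> y \<in> K \<Longrightarrow> sg (x + y) = sg x + sg y"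
  by (elim K_cases) (simp add: elt_add)

lemma sg_diff: "x \<in> K \<Longrightarrow> y \<in> K \<Longrightarrow> sg (x - y) = sg x - sg y"
  by (elim K_cases) (simp add: elt_diff)

lemma sg_minus: "x \<in> K \<Longrightarrow> sg (- x) = - sg x"
  by (elim K_cases) (simp add: elt_minus)

lemma sg_mult: "x \<in> K \<Longrightarrow> y \<in> K \<Longrightarrow> sg (x * y) = sg x * sg y"
  by (elim K_cases) (simp add: elt_mult elt_inject algebra_simps)

lemma sg_of_rat [simp]: "sg (of_rat q) = of_rat q"
  by (simp add: rat_elt)

lemma sg_of_int [simp]: "sg (of_int n) = of_int n"
  by (simp add: of_int_elt)

lemma sg_1 [simp]: "sg 1 = 1" and sg_0 [simp]: "sg 0 = 0"
  using sg_of_int[of 1] sg_of_int[of 0] by simp_all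

lemma sg_w [simp]: "sg w = - w" and sg_e [simp]: "sg e = f" and sg_f [simp]: "sg f = - e"
  using sg_elt[of 0 1 0 0] sg_elt[of 0 0 1 0] sg_elt[of 0 0 0 1]
  by (simp_all add: elt_def)

lemma sg_eq_0_iff: "x \<in> K \<Longrightarrow> sg x = 0 \<longleftrightarrow> x = 0"
  by (elim K_cases) (auto simp: elt_eq_0_iff)

lemma sg4: "sg (sg (sg (sg x))) = x"
  by (cases "x \<in> K") (auto elim!: K_cases simp: sg_notin)

lemma K_inverse:
  assumes "x \<in> K"
  shows "inverse x \<in> K"
proof (cases "x = 0")
  case False
  obtain x0 x1 x2 x3 where x: "x = elt x0 x1 x2 x3" using assms by (rule K_cases)
  \<comment> \<open>The denominator is cleared in two stages: \<open>x * y\<close> lies in Q(w), and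
    its product with its own conjugate is a nonzero rational.\<close>
  define y where "y = sg (sg x)"
  have "\<exists>u v. x * y = elt u v 0 0" unfolding y_def x by (simp add: elt_mult elt_inject)
  then obtain u v where uv: "x * y = elt u v 0 0" by blast
  have "x * y \<noteq> 0" using False assms by (simp add: y_def sg_eq_0_iff sg_K)
  hence "elt u (-v) 0 0 \<noteq> 0" using uv by (auto simp: elt_eq_0_iff)
  moreover have "elt u v 0 0 * elt u (-v) 0 0 = of_rat (u * u - d * v * v)"
    by (simp add: elt_mult rat_elt)
  ultimately have "of_rat (u * u - d * v * v) \<noteq> (0::complex)"
    and "x * (y * elt u (-v) 0 0) = of_rat (u * u - d * v * v)"
    using uv \<open>x * y \<noteq> 0\<close> by (auto simp flip: mult.assoc)
  hence "x * (y * elt u (-v) 0 0 * of_rat (inverse (u * u - d * v * v))) = 1"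
    by (simp add: of_rat_inverse flip: mult.assoc)
  hence "inverse x = y * elt u (-v) 0 0 * of_rat (inverse (u * u - d * v * v))"
    by (rule inverse_unique)
  thus ?thesis using assms by (auto simp: y_def intro!: K_mult K_of_rat sg_K)
qed (auto simp: K_0)

lemma sg_inverse: "x \<in> K \<Longrightarrow> sg (inverse x) = inverse (sg x)"
proof (cases "x = 0")
  case False
  assume x: "x \<in> K"
  have "sg x * sg (inverse x) = 1"
    using x False by (simp flip: sg_mult add: K_inverse)
  thus ?thesis by (metis inverse_unique)
qed simp

lemma KK: "w \<in> K" "e \<in> K" "f \<in> K"
  using elt_in_K[of 0 1 0 0] elt_in_K[of 0 0 1 0] elt_in_K[of 0 0 0 1]
  by (simp_all add: elt_def)

lemma K_is_subfield: "is_subfield K"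
  unfolding is_subfield_def by (auto intro: K_0 K_1 K_add K_mult K_minus K_inverse)

lemma K_subset_subfield:
  assumes sub: "is_subfield L" and "w \<in> L" "e \<in> L" "f \<in> L"
  shows "K \<subseteq> L"
proof -
  have "x + y \<in> L" "x * y \<in> L" if "x \<in> L" "y \<in> L" for x y
    using sub that unfolding is_subfield_def by auto
  thus ?thesis unfolding K_def elt_def using assms subfield_of_rat[OF sub] by auto
qed

section \<open>The Galois group\<close>

lemma sg_in_galois_group: "sg \<in> galois_group K"
proof -
  have "bij_betw sg K K"
    by (rule bij_betwI[where g = "\<lambda>x. sg (sg (sg x))"]) (auto simp: sg4 sg_K)
  thus ?thesis unfolding galois_group_def
    by (auto simp: sg_add sg_mult sg_notin elim: Rats_cases)
qed

lemma galois_group_determined: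
  assumes "\<tau> \<in> galois_group K" "\<rho> \<in> galois_group K" "\<tau> w = \<rho> w" "\<tau> e = \<rho> e" "\<tau> f = \<rho> f"
  shows "\<tau> = \<rho>"
proof
  fix x
  have val: "\<phi> (elt x0 x1 x2 x3) = of_rat x0 + of_rat x1 * \<phi> w + of_rat x2 * \<phi> e + of_rat x3 * \<phi> f"
    if "\<phi> \<in> galois_group K" for \<phi> x0 x1 x2 x3
  proof -
    have "\<phi> (u + v) = \<phi> u + \<phi> v" "\<phi> (u * v) = \<phi> u * \<phi> v" if "u \<in> K" "v \<in> K" for u v
      using \<open>\<phi> \<in> galois_group K\<close> that unfolding galois_group_def by auto
    moreover have "\<phi> (of_rat q) = of_rat q" for q
      using that unfolding galois_group_def by auto
    ultimately show ?thesis unfolding elt_def by (simp add: K_add K_mult K_of_rat KK)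
  qed
  show "\<tau> x = \<rho> x"
  proof (cases "x \<in> K")
    case True
    then obtain x0 x1 x2 x3 where "x = elt x0 x1 x2 x3" by (rule K_cases)
    thus ?thesis using assms by (simp add: val)
  next
    case False
    thus ?thesis using assms(1,2) unfolding galois_group_def by simp
  qed
qed

lemma galois_group_comp:
  assumes "\<tau> \<in> galois_group K" "\<rho> \<in> galois_group K"
  shows "\<tau> \<circ> \<rho> \<in> galois_group K"
proof -
  have "\<rho> x \<in> K" if "x \<in> K" for x
    using assms(2) that unfolding galois_group_def bij_betw_def by auto
  thus ?thesis using assms unfolding galois_group_def by (auto intro: bij_betw_trans)
qed

lemma id_in_galois_group: "id \<in> galois_group K"
  unfolding galois_group_def by auto

lemma sg_pow_in_galois_group: "sg ^^ k \<in> galois_group K"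
proof (induction k)
  case (Suc k)
  thus ?case unfolding funpow.simps by (rule galois_group_comp[OF sg_in_galois_group])
qed (use id_in_galois_group in \<open>simp add: id_def\<close>)

lemma e0: "e \<noteq> 0" and f0: "f \<noteq> 0"
  using ww ef d0 a0 c0 by auto

text \<open>An automorphism sends \<open>w\<close> to a square root of \<open>d\<close>, hence
  \<open>e\<close> to a square root of one of the two radicands, and \<open>ef\<close> then fixes
  the image of \<open>f\<close>. Each of the four outcomes is a power of \<open>sg\<close>.\<close>

lemma galois_group_eq: "galois_group K = {sg ^^ 0, sg ^^ 1, sg ^^ 2, sg ^^ 3}"
proof
  show "{sg ^^ 0, sg ^^ 1, sg ^^ 2, sg ^^ 3} \<subseteq> galois_group K"
    using sg_pow_in_galois_group by blast
  show "galois_group K \<subseteq> {sg ^^ 0, sg ^^ 1, sg ^^ 2, sg ^^ 3}"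
  proof
    fix \<tau> assume \<tau>: "\<tau> \<in> galois_group K"
    have add: "\<tau> (u + v) = \<tau> u + \<tau> v" and mult: "\<tau> (u * v) = \<tau> u * \<tau> v"
      if "u \<in> K" "v \<in> K" for u v
      using \<tau> that unfolding galois_group_def by auto
    have rat: "\<tau> (of_rat q) = of_rat q" for q
      using \<tau> unfolding galois_group_def by auto
    have "\<tau> w * \<tau> w = w * w" using mult[of w w] rat[of d] by (simp add: KK ww)
    hence w: "\<tau> w = w \<or> \<tau> w = - w" by (simp add: square_eq_iff)
    have e: "\<tau> e * \<tau> e = of_rat c * (of_rat d + of_rat b * \<tau> w)"
      using mult[of e e] by (simp add: KK ee mult add rat K_add K_mult K_of_rat)
    have f: "\<tau> e * \<tau> f = of_rat c * of_rat a * \<tau> w"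
      using mult[of e f] by (simp add: KK ef mult add rat K_add K_mult K_of_rat)
    have "\<exists>k\<in>{0,1,2,3}. (sg ^^ k) w = \<tau> w \<and> (sg ^^ k) e = \<tau> e \<and> (sg ^^ k) f = \<tau> f"
      using w
    proof
      assume w: "\<tau> w = w"
      hence "\<tau> e * \<tau> e = e * e" using e ee by simp
      hence "\<tau> e = e \<or> \<tau> e = - e" by (simp add: square_eq_iff)
      thus ?thesis
      proof
        assume "\<tau> e = e"
        moreover from this have "\<tau> f = f" using f ef e0 w by (metis mult_left_cancel)
        ultimately show ?thesis using w by simp
      next
        assume "\<tau> e = - e"
        moreover from this have "e * (- \<tau> f) = e * f" using f ef w by simp
        hence "\<tau> f = - f" using e0 by (metis mult_left_cancel minus_minus)
        ultimately show ?thesis using w by (intro bexI[of _ 2]) (simp_all add: numeral_2_eq_2 sg_minus KK)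
      qed
    next
      assume w: "\<tau> w = - w"
      hence "\<tau> e * \<tau> e = f * f" using e ff by simp
      hence "\<tau> e = f \<or> \<tau> e = - f" by (simp add: square_eq_iff)
      thus ?thesis
      proof
        assume "\<tau> e = f"
        moreover from this have "f * (- \<tau> f) = f * e" using f ef w by (simp add: mult.commute)
        hence "\<tau> f = - e" using f0 by (metis mult_left_cancel minus_minus)
        ultimately show ?thesis using w by (intro bexI[of _ 1]) simp_all
      next
        assume "\<tau> e = - f"
        moreover from this have "f * \<tau> f = f * e" using f ef w by (simp add: mult.commute)
        hence "\<tau> f = e" using f0 by (metis mult_left_cancel)
        ultimately show ?thesis using w by (intro bexI[of _ 3]) (simp_all add: numeral_3_eq_3 sg_minus KK)
      qed
    qed
    then obtain k where k: "k \<in> {0,1,2,3}" "(sg ^^ k) w = \<tau> w" "(sg ^^ k) e = \<tau> e" "(sg ^^ k) f = \<tau> f"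
      by blast
    have "\<tau> = sg ^^ k"
      by (rule galois_group_determined) (use k \<tau> sg_pow_in_galois_group in auto)
    thus "\<tau> \<in> {sg ^^ 0, sg ^^ 1, sg ^^ 2, sg ^^ 3}" using k(1) by auto
  qed
qed

text \<open>The four powers of \<open>sg\<close> are told apart by their values e, f, -e, -f at
  \<open>e\<close>.\<close>

lemma cyclic_galois_group: "cyclic_of_order 4 (galois_group K)"
proof -
  have val: "(sg ^^ 0) e = elt 0 0 1 0" "(sg ^^ 1) e = elt 0 0 0 1"
    "(sg ^^ 2) e = elt 0 0 (-1) 0" "(sg ^^ 3) e = elt 0 0 0 (-1)"
    by (simp_all add: elt_def numeral_2_eq_2 numeral_3_eq_3 sg_minus KK)
  have "inj_on (\<lambda>k. sg ^^ k) {0,1,2,3}"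
  proof (rule inj_onI)
    fix i j :: nat assume ij: "i \<in> {0,1,2,3}" "j \<in> {0,1,2,3}" and eq: "sg ^^ i = sg ^^ j"
    hence "(sg ^^ i) e = (sg ^^ j) e" by simp
    moreover have "(sg ^^ i) e = elt 0 0 (if i = 0 then 1 else if i = 2 then -1 else 0) (if i = 1 then 1 else if i = 3 then -1 else 0)"
      "(sg ^^ j) e = elt 0 0 (if j = 0 then 1 else if j = 2 then -1 else 0) (if j = 1 then 1 else if j = 3 then -1 else 0)"
      using ij val by auto
    ultimately show "i = j" using ij by (auto simp: elt_inject split: if_splits)
  qed
  from card_image[OF this] have "card (galois_group K) = 4"
    by (simp add: galois_group_eq)
  moreover have "\<forall>\<tau>\<in>galois_group K. \<exists>k. \<tau> = sg ^^ k" unfolding galois_group_eq by blast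
  ultimately show ?thesis unfolding cyclic_of_order_def using sg_in_galois_group by blast
qed

end

section \<open>Units of real quadratic fields and elementary estimates\<close>

text \<open>For positive nonsquare \<open>d\<close> these are the units of Z[sqrt d], kept as real
  numbers so that they can be compared in size.\<close>

definition pell :: "int \<Rightarrow> real \<Rightarrow> bool" where
  "pell d \<theta> \<longleftrightarrow> (\<exists>x y. \<theta> = of_int x + of_int y * sqrt (of_int d) \<and> \<bar>x\<^sup>2 - d * y\<^sup>2\<bar> = 1)"

lemma pell_mult:
  assumes "d \<ge> 0" "pell d \<theta>" "pell d \<phi>"
  shows "pell d (\<theta> * \<phi>)"
proof -
  obtain x y where 1: "\<theta> = of_int x + of_int y * sqrt (of_int d)" "\<bar>x\<^sup>2 - d * y\<^sup>2\<bar> = 1"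
    using assms unfolding pell_def by auto
  obtain u v where 2: "\<phi> = of_int u + of_int v * sqrt (of_int d)" "\<bar>u\<^sup>2 - d * v\<^sup>2\<bar> = 1"
    using assms unfolding pell_def by auto
  have "sqrt (of_int d) * sqrt (of_int d) = of_int d" using assms(1) by simp
  hence "\<theta> * \<phi> = of_int (x * u + d * y * v) + of_int (x * v + y * u) * sqrt (of_int d)"
    unfolding 1 2 by (simp add: algebra_simps)
  moreover have "(x * u + d * y * v)\<^sup>2 - d * (x * v + y * u)\<^sup>2 = (x\<^sup>2 - d * y\<^sup>2) * (u\<^sup>2 - d * v\<^sup>2)"
    by (simp add: power2_eq_square algebra_simps)
  hence "\<bar>(x * u + d * y * v)\<^sup>2 - d * (x * v + y * u)\<^sup>2\<bar> = 1" using 1 2 by (simp add: abs_mult)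
  ultimately show ?thesis unfolding pell_def by blast
qed

lemma pell_inverse:
  assumes "d \<ge> 0" "pell d \<theta>"
  shows "\<theta> \<noteq> 0" "pell d (inverse \<theta>)"
proof -
  obtain x y where 1: "\<theta> = of_int x + of_int y * sqrt (of_int d)" "\<bar>x\<^sup>2 - d * y\<^sup>2\<bar> = 1"
    using assms unfolding pell_def by auto
  define n where "n = x\<^sup>2 - d * y\<^sup>2"
  have n: "n * n = 1" using 1(2) unfolding n_def by (metis abs_mult_self_eq mult_1)
  have "sqrt (of_int d) * sqrt (of_int d) = of_int d" using assms(1) by simp
  hence "\<theta> * (of_int x - of_int y * sqrt (of_int d)) = of_int n"
    unfolding 1 n_def by (simp add: power2_eq_square algebra_simps)
  hence "of_int n * (\<theta> * (of_int x - of_int y * sqrt (of_int d))) = of_int (n * n)" by simp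
  hence "\<theta> * (of_int (n * x) + of_int (- (n * y)) * sqrt (of_int d)) = of_int (n * n)"
    by (simp add: algebra_simps)
  hence 2: "\<theta> * (of_int (n * x) + of_int (- (n * y)) * sqrt (of_int d)) = 1" by (simp add: n)
  thus "\<theta> \<noteq> 0" by auto
  from 2 have "inverse \<theta> = of_int (n * x) + of_int (- (n * y)) * sqrt (of_int d)"
    by (rule inverse_unique)
  moreover have "(n * x)\<^sup>2 - d * (- (n * y))\<^sup>2 = (n * n) * (x\<^sup>2 - d * y\<^sup>2)"
    by (simp add: power2_eq_square algebra_simps)
  hence "\<bar>(n * x)\<^sup>2 - d * (- (n * y))\<^sup>2\<bar> = 1" using 1(2) n by simp
  ultimately show "pell d (inverse \<theta>)" unfolding pell_def by blast
qed

lemma pell_1: "pell d 1"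
  unfolding pell_def by (rule exI[of _ 1], rule exI[of _ 0]) simp

lemma pell_minus: "pell d \<theta> \<Longrightarrow> pell d (- \<theta>)"
proof -
  assume "pell d \<theta>"
  then obtain x y where 1: "\<theta> = of_int x + of_int y * sqrt (of_int d)" "\<bar>x\<^sup>2 - d * y\<^sup>2\<bar> = 1"
    unfolding pell_def by auto
  thus ?thesis unfolding pell_def by (intro exI[of _ "- x"] exI[of _ "- y"]) simp
qed

lemma pell_power_int: "d \<ge> 0 \<Longrightarrow> pell d \<theta> \<Longrightarrow> pell d (\<theta> powi j)"
proof -
  assume d: "d \<ge> 0" and \<theta>: "pell d \<theta>"
  have "pell d (\<phi> ^ k)" if "pell d \<phi>" for \<phi> k
    by (induction k) (auto intro: pell_1 pell_mult d that)
  thus ?thesis unfolding power_int_def using pell_inverse[OF d] \<theta> by auto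
qed

definition pell_unit :: "int \<Rightarrow> real" where
  "pell_unit s = of_int (s\<^sup>2 + 1) + of_int s * sqrt (of_int (s\<^sup>2 + 2))"

lemma pell_pell_unit: "pell (s\<^sup>2 + 2) (pell_unit s)"
  unfolding pell_def pell_unit_def
  by (rule exI[of _ "s\<^sup>2 + 1"], rule exI[of _ s]) (simp add: power2_eq_square algebra_simps)

text \<open>A unit above 1 has a conjugate below 1 in absolute value, so x and y are positive. With
  \<open>n\<close> the norm, x^2 = (s y)^2 + 2 y^2 + n forces x > s y, and comparing squares gives y
  >= s. If y > s, then \<theta> is at least \<open>pell_unit s\<close>; if y = s, then n = 1 and
  \<theta> equals it.\<close>

lemma pell_fundamental_aux:
  assumes "s > 0" "pell (s\<^sup>2 + 2) \<theta>" "1 \<le> \<theta>" "\<theta> < pell_unit s"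
  shows "\<theta> = 1"
proof (rule ccontr)
  assume "\<theta> \<noteq> 1"
  hence gt: "\<theta> > 1" using assms by simp
  define r where "r = sqrt (of_int (s\<^sup>2 + 2))"
  have r: "r * r = of_int s * of_int s + 2" unfolding r_def by (simp add: power2_eq_square)
  have rpos: "r > 0" unfolding r_def by (simp add: add_nonneg_pos)
  have rs: "r > of_int s"
    unfolding r_def using assms(1) by (intro real_less_rsqrt) simp
  obtain x y where 1: "\<theta> = of_int x + of_int y * r" "\<bar>x\<^sup>2 - (s\<^sup>2 + 2) * y\<^sup>2\<bar> = 1"
    using assms(2) unfolding pell_def r_def by blast
  define n where "n = x\<^sup>2 - (s\<^sup>2 + 2) * y\<^sup>2"
  have n: "n = 1 \<or> n = -1" using 1(2) unfolding n_def by linarith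
  define \<theta>' where "\<theta>' = of_int x - of_int y * r"
  have prod: "\<theta> * \<theta>' = of_int n"
  proof -
    have "\<theta> * \<theta>' = of_int x * of_int x - of_int y * of_int y * (r * r)"
      unfolding 1 \<theta>'_def by (simp add: algebra_simps)
    thus ?thesis unfolding r n_def by (simp add: power2_eq_square algebra_simps)
  qed
  have "\<bar>\<theta>\<bar> * \<bar>\<theta>'\<bar> = 1" using n unfolding abs_mult[symmetric] prod by auto
  hence "\<bar>\<theta>'\<bar> = 1 / \<theta>" using gt by (simp add: field_simps)
  hence small: "\<bar>\<theta>'\<bar> < 1" using gt by simp
  have "2 * of_int x = \<theta> + \<theta>'" "2 * (of_int y * r) = \<theta> - \<theta>'" unfolding 1 \<theta>'_def by simp_all
  hence "of_int x > (0::real)" "of_int y * r > 0" using small gt by linarith+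
  hence x: "x > 0" and y: "y > 0" using rpos by (simp_all add: zero_less_mult_iff)
  have less: "of_int x + of_int y * r < of_int (s\<^sup>2 + 1) + of_int s * r"
    using assms(4) unfolding 1 pell_unit_def r_def .
  have eqx: "x\<^sup>2 = (s * y)\<^sup>2 + 2 * y\<^sup>2 + n" unfolding n_def by (simp add: power2_eq_square algebra_simps)
  have y1: "y\<^sup>2 \<ge> 1" using y by (simp add: power2_eq_square) (metis int_one_le_iff_zero_less zero_less_mult_iff)
  have "(s * y)\<^sup>2 < x\<^sup>2" using eqx y1 n by linarith
  hence "s * y < x" using x by (simp add: power_less_imp_less_base)
  then obtain j where j: "x = s * y + j" "j \<ge> 1" by (metis add.commute diff_add_cancel zless_add1_eq zle_diff1_eq int_one_le_iff_zero_less diff_gt_0_iff_gt)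
  have "2 * (s * y) * j + j\<^sup>2 = 2 * y\<^sup>2 + n" using eqx unfolding j by (simp add: power2_eq_square algebra_simps)
  moreover have "2 * (s * y) * j \<ge> 2 * (s * y)" using j assms(1) y by simp
  moreover have "j\<^sup>2 \<ge> 1" using j(2) by (simp add: one_le_power)
  ultimately have *: "2 * (s * y) + 1 \<le> 2 * y\<^sup>2 + n" by linarith
  have "s \<le> y"
  proof (rule ccontr)
    assume "\<not> s \<le> y"
    hence "(y + 1) * y \<le> s * y" using y by (intro mult_right_mono) auto
    thus False using * y n by (auto simp: power2_eq_square algebra_simps)
  qed
  moreover have "y \<noteq> s \<or> n = 1" using * n by (auto simp: power2_eq_square)
  moreover have False if "y \<ge> s + 1"
  proof -
    have "s * (s + 1) \<le> s * y" using that assms(1) by (intro mult_left_mono) auto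
    hence "x \<ge> s\<^sup>2 + 1" using j assms(1) by (simp add: power2_eq_square algebra_simps)
    hence "of_int x \<ge> (of_int (s\<^sup>2 + 1) :: real)" by (simp only: of_int_le_iff)
    moreover have "of_int y * r \<ge> of_int s * r" using that rpos by simp
    ultimately show False using less by linarith
  qed
  moreover have False if "y = s" "n = 1"
  proof -
    have "x\<^sup>2 = (s\<^sup>2 + 1)\<^sup>2" using eqx that by (simp add: power2_eq_square algebra_simps)
    hence "x = s\<^sup>2 + 1" using x by (simp add: power2_eq_iff_nonneg)
    thus False using less that by simp
  qed
  ultimately show False by linarith
qed

lemma pell_unit_gt_1: "s > 0 \<Longrightarrow> pell_unit s > 1"
proof -
  assume "s > 0"
  hence "real_of_int s * sqrt (of_int (s\<^sup>2 + 2)) > 0" "real_of_int (s\<^sup>2) > 0"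
    by (simp_all add: add_nonneg_pos)
  thus ?thesis unfolding pell_unit_def of_int_add of_int_1 by linarith
qed

lemma pell_unit_minus: "pell_unit (- s) = inverse (pell_unit s)"
proof -
  have "sqrt (of_int (s\<^sup>2 + 2)) * sqrt (of_int (s\<^sup>2 + 2)) = of_int s * of_int s + 2"
    by (simp add: power2_eq_square)
  hence "pell_unit s * pell_unit (- s) = 1"
    unfolding pell_unit_def by (simp add: power2_eq_square algebra_simps)
  thus ?thesis by (metis inverse_unique)
qed

text \<open>Dividing by the power of the unit whose exponent is the floor of the logarithm lands in
  the interval from 1 to the unit, where 1 is the only candidate. Negative \<open>s\<close> is
  reduced to \<open>- s\<close>, which inverts the unit.\<close>

lemma pell_fundamental:
  assumes "s \<noteq> 0" "pell (s\<^sup>2 + 2) \<theta>"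
  obtains j where "\<bar>\<theta>\<bar> = pell_unit s powi j"
proof -
  have pos: "\<exists>j. \<bar>\<theta>\<bar> = pell_unit t powi j" if t: "t > 0" "pell (t\<^sup>2 + 2) \<theta>" for t
  proof -
    define \<eta> where "\<eta> = pell_unit t"
    have \<eta>: "\<eta> > 1" using pell_unit_gt_1 t unfolding \<eta>_def by simp
    define \<phi> where "\<phi> = \<bar>\<theta>\<bar>"
    have d: "t\<^sup>2 + 2 \<ge> 0" by (simp add: add_nonneg_nonneg)
    have \<phi>: "pell (t\<^sup>2 + 2) \<phi>" unfolding \<phi>_def abs_if using t(2) pell_minus by auto
    have \<phi>0: "\<phi> > 0" using pell_inverse(1)[OF d t(2)] unfolding \<phi>_def by simp
    define j where "j = \<lfloor>log \<eta> \<phi>\<rfloor>"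
    have p: "\<eta> powi i = \<eta> powr of_int i" for i using \<eta> by (simp add: powr_real_of_int')
    have le: "\<eta> powi j \<le> \<phi>" unfolding p using \<eta> \<phi>0 by (subst le_log_iff[symmetric]) (auto simp: j_def)
    have "\<phi> < \<eta> powr (of_int j + 1)" using \<eta> \<phi>0 unfolding j_def
      by (subst log_less_iff[symmetric]) (auto intro: floor_correct)
    also have "\<dots> = \<eta> * \<eta> powi j" using \<eta> by (simp add: powr_add p)
    finally have lt: "\<phi> < \<eta> * \<eta> powi j" .
    have pp: "\<eta> powi j > 0" using \<eta> by simp
    have "\<phi> * inverse (\<eta> powi j) = 1"
    proof (rule pell_fundamental_aux[OF t(1)])
      show "pell (t\<^sup>2 + 2) (\<phi> * inverse (\<eta> powi j))"
        unfolding \<eta>_def by (intro pell_mult d \<phi> pell_inverse(2) pell_power_int pell_pell_unit)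
      show "1 \<le> \<phi> * inverse (\<eta> powi j)" using le pp by (simp add: field_simps)
      show "\<phi> * inverse (\<eta> powi j) < pell_unit t" using lt pp unfolding \<eta>_def[symmetric] by (simp add: field_simps)
    qed
    hence "\<phi> = \<eta> powi j" using pp by (simp add: field_simps)
    thus ?thesis unfolding \<phi>_def \<eta>_def by blast
  qed
  show ?thesis
  proof (cases "s > 0")
    case True
    thus ?thesis using pos assms that by blast
  next
    case False
    then obtain j where "\<bar>\<theta>\<bar> = pell_unit (- s) powi j" using pos[of "- s"] assms by auto
    hence "\<bar>\<theta>\<bar> = pell_unit s powi (- j)" by (simp add: pell_unit_minus power_int_minus power_int_inverse)
    thus ?thesis by (rule that)
  qed
qed

text \<open>With T = P + Q sqrt d and \<delta> = 1 or -1, the equation says that T^2 - 4 \<delta>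
  has norm d r^2. For odd \<open>Q\<close>, evenness of \<open>d\<close> makes \<open>P\<close>
  even, so P^2 - d Q^2 = 2 X with X odd. Dividing out powers of 2 makes first \<open>r\<close> and
  then X^2 even, a contradiction.\<close>

lemma even_of_norm_equation:
  fixes P Q \<delta> r d :: int
  assumes d: "d mod 4 = 2" and eq: "(P\<^sup>2 - d * Q\<^sup>2)\<^sup>2 - 8 * \<delta> * (P\<^sup>2 + d * Q\<^sup>2) + 16 = d * r\<^sup>2"
  shows "even Q"
proof (rule ccontr)
  assume Q: "odd Q"
  define k where "k = d div 4"
  have dk: "d = 2 * (2 * k + 1)" using d unfolding k_def by presburger
  have "even (d * r\<^sup>2)" using dk by simp
  hence "even P" unfolding eq[symmetric] using dk by simp
  then obtain p where p: "P = 2 * p" by blast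
  define X where "X = 2 * p\<^sup>2 - (2 * k + 1) * Q\<^sup>2"
  have oddX: "odd X" using Q unfolding X_def by simp
  have "P\<^sup>2 - d * Q\<^sup>2 = 2 * X" unfolding X_def p dk by (simp add: power2_eq_square algebra_simps)
  hence 1: "4 * X\<^sup>2 - 8 * \<delta> * (P\<^sup>2 + d * Q\<^sup>2) + 16 = 2 * ((2 * k + 1) * r\<^sup>2)"
    using eq dk by (simp add: power2_eq_square algebra_simps)
  hence "2 * X\<^sup>2 - 4 * \<delta> * (P\<^sup>2 + d * Q\<^sup>2) + 8 = (2 * k + 1) * r\<^sup>2" by linarith
  moreover from this have "even ((2 * k + 1) * r\<^sup>2)" by (metis (no_types) dvd_add dvd_diff even_mult_iff even_numeral)
  hence "even r" by simp
  then obtain q where q: "r = 2 * q" by blast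
  ultimately have "X\<^sup>2 = 2 * (\<delta> * (P\<^sup>2 + d * Q\<^sup>2) - 2 + (2 * k + 1) * q\<^sup>2)"
    by (simp add: power2_eq_square algebra_simps)
  hence "even (X\<^sup>2)" by (metis dvd_triv_left)
  thus False using oddX by simp
qed

text \<open>One of the pairs exp t + exp (-t) reaches 2 sqrt(S^2 + 2). For |t| <= ln (2 S) it would
  be at most 2 S + 1/(2 S), whose square 4 S^2 + 2 + 1/(4 S^2) is below 4 S^2 + 8.\<close>

lemma cosh_sum_bound:
  fixes x y S :: real
  assumes "1 \<le> S" and ge: "4 * sqrt (S\<^sup>2 + 2) \<le> exp x + exp (- x) + exp y + exp (- y)"
  shows "(ln (2 * S))\<^sup>2 < x\<^sup>2 + y\<^sup>2"
proof -
  have *: "\<bar>t\<bar> > ln (2 * S)" if t: "2 * sqrt (S\<^sup>2 + 2) \<le> exp t + exp (- t)" for t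
  proof (rule ccontr)
    assume "\<not> \<bar>t\<bar> > ln (2 * S)"
    hence "exp \<bar>t\<bar> \<le> exp (ln (2 * S))" by (subst exp_le_cancel_iff) simp
    hence le: "exp \<bar>t\<bar> \<le> 2 * S" using assms by simp
    define E where "E = exp \<bar>t\<bar>"
    have E: "E \<ge> 1" "E \<le> 2 * S" using le unfolding E_def by auto
    have "E + inverse E \<le> 2 * S + inverse (2 * S)"
    proof -
      \<comment> \<open>This factorisation expresses the monotonicity of E + 1/E for E >= 1.\<close>
      have "2 * S + inverse (2 * S) - (E + inverse E) = (2 * S - E) * (1 - inverse (2 * S * E))"
        using E assms by (simp add: field_simps)
      moreover have "inverse (2 * S * E) \<le> 1" using E assms
        by (intro inverse_le_1_iff[THEN iffD2]) (simp add: mult_ge1_I[of "2*S" E] )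
      ultimately show ?thesis using E by (metis diff_ge_0_iff_ge mult_nonneg_nonneg)
    qed
    moreover have "exp t + exp (- t) = E + inverse E"
      unfolding E_def by (cases "t \<ge> 0") (auto simp: exp_minus)
    moreover have "inverse (2 * S) \<le> 1 / 2" using assms(1) by (simp add: field_simps)
    ultimately have "2 * sqrt (S\<^sup>2 + 2) \<le> 2 * S + inverse (2 * S)" using t by linarith
    hence "(2 * sqrt (S\<^sup>2 + 2))\<^sup>2 \<le> (2 * S + inverse (2 * S))\<^sup>2" by (intro power_mono) auto
    moreover have "(2 * S + inverse (2 * S))\<^sup>2 = 4 * S\<^sup>2 + 2 + (inverse (2 * S))\<^sup>2"
      using assms(1) by (simp add: power2_eq_square field_simps)
    moreover have "(inverse (2 * S))\<^sup>2 \<le> 1" using \<open>inverse (2 * S) \<le> 1 / 2\<close> assms(1)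
      by (intro power_le_one) auto
    ultimately show False by (simp add: power_mult_distrib)
  qed
  have l: "ln (2 * S) \<ge> 0" using assms(1) by simp
  have "2 * sqrt (S\<^sup>2 + 2) \<le> exp x + exp (- x) \<or> 2 * sqrt (S\<^sup>2 + 2) \<le> exp y + exp (- y)"
    using ge by linarith
  thus ?thesis
  proof
    assume "2 * sqrt (S\<^sup>2 + 2) \<le> exp x + exp (- x)"
    from *[OF this] have "(ln (2 * S))\<^sup>2 < \<bar>x\<bar>\<^sup>2" using l by (intro power_strict_mono) auto
    hence "(ln (2 * S))\<^sup>2 < x\<^sup>2" by simp
    also have "\<dots> \<le> x\<^sup>2 + y\<^sup>2" by simp
    finally show ?thesis .
  next
    assume "2 * sqrt (S\<^sup>2 + 2) \<le> exp y + exp (- y)"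
    from *[OF this] have "(ln (2 * S))\<^sup>2 < \<bar>y\<bar>\<^sup>2" using l by (intro power_strict_mono) auto
    moreover have "x\<^sup>2 \<ge> 0" by simp
    ultimately show ?thesis by (simp add: add_strict_increasing2)
  qed
qed

text \<open>For q = u/v in lowest terms, v^2 divides d u^2 and hence \<open>d\<close>, so
  \<open>v\<close> is a unit.\<close>

lemma squarefree_mult_square_int:
  fixes d :: int and q :: rat
  assumes "squarefree d" "of_int d * q\<^sup>2 \<in> \<int>"
  shows "q \<in> \<int>"
proof -
  obtain u v where uv: "q = of_int u / of_int v" "v > 0" "coprime u v"
    by (cases q) (auto simp: Fract_of_int_quotient)
  obtain z where z: "of_int d * q\<^sup>2 = (of_int z :: rat)" using assms(2) by (auto elim: Ints_cases)
  have "(of_int (d * u\<^sup>2) :: rat) = of_int (z * v\<^sup>2)"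
    using z uv by (simp add: field_simps)
  hence "d * u\<^sup>2 = z * v\<^sup>2" by (simp only: of_int_eq_iff)
  hence "v\<^sup>2 dvd d * u\<^sup>2" by simp
  moreover have "coprime (v\<^sup>2) (u\<^sup>2)" using uv(3) by (simp add: coprime_commute)
  ultimately have "v\<^sup>2 dvd d" by (metis coprime_dvd_mult_left_iff)
  hence "is_unit v" using assms(1) unfolding squarefree_def by blast
  hence "v = 1" using uv by simp
  thus ?thesis using uv by simp
qed

section \<open>Integers and units of the quartic field\<close>

context cyclic_quartic
begin

lemma sg_algebraic_integer:
  assumes "x \<in> K" "algebraic_integer x"
  shows "algebraic_integer (sg x)"
proof -
  obtain p :: "int poly" where p: "lead_coeff p = 1" "poly (map_poly of_int p) x = 0"
    using assms unfolding algebraic_integer_def by auto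
  have "poly (map_poly of_int q) x \<in> K \<and>
      sg (poly (map_poly of_int q) x) = poly (map_poly of_int q) (sg x)" for q :: "int poly"
    by (induction q) (auto simp: map_poly_pCons assms sg_add sg_mult K_add K_mult K_of_int K_0)
  hence "poly (map_poly of_int p) (sg x) = 0" using p by (metis sg_0)
  thus ?thesis using p(1) unfolding algebraic_integer_def by blast
qed

definition U :: "complex set" where "U = unit_group K"

lemma U_iff: "u \<in> U \<longleftrightarrow> u \<in> K \<and> u \<noteq> 0 \<and> algebraic_integer u \<and> algebraic_integer (inverse u)"
  unfolding U_def unit_group_def ring_of_integers_def by (auto simp: K_inverse)

lemma U_mult: "u \<in> U \<Longrightarrow> v \<in> U \<Longrightarrow> u * v \<in> U"
  unfolding U_iff by (auto simp: K_mult algebraic_integer_add_mult)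

lemma U_inverse: "u \<in> U \<Longrightarrow> inverse u \<in> U"
  unfolding U_iff by (auto simp: K_inverse)

lemma U_1: "1 \<in> U"
  unfolding U_iff using algebraic_integer_of_int[of 1] by (simp add: K_1)

lemma U_minus: "u \<in> U \<Longrightarrow> - u \<in> U"
  unfolding U_iff by (auto simp: K_minus algebraic_integer_minus)

lemma U_power_int: "u \<in> U \<Longrightarrow> u powi j \<in> U"
proof -
  assume u: "u \<in> U"
  have "v ^ k \<in> U" if "v \<in> U" for v k
    by (induction k) (auto intro: U_1 U_mult that)
  thus ?thesis unfolding power_int_def using U_inverse u by auto
qed

lemma sg_U: "u \<in> U \<Longrightarrow> sg u \<in> U"
  unfolding U_iff using sg_algebraic_integer[of u] sg_algebraic_integer[of "inverse u"]
  by (auto simp: sg_K sg_inverse sg_eq_0_iff K_inverse)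

lemma sg_power_int: "u \<in> K \<Longrightarrow> sg (u powi j) = sg u powi j"
proof -
  assume u: "u \<in> K"
  have "v ^ k \<in> K \<and> sg (v ^ k) = sg v ^ k" if "v \<in> K" for v k
    by (induction k) (auto simp: K_1 K_mult sg_mult that)
  thus ?thesis unfolding power_int_def using u K_inverse sg_inverse by auto
qed

text \<open>The integers of Q(w) are Z[w]. Trace and norm show that P = 2 p and Q = 2 q are integers
  with dd Q^2 = P^2 - 4 N. As \<open>dd\<close> is even, so is P; as dd/2 is odd, so is Q
  even.\<close>

lemma integer_in_quadratic_subfield:
  fixes dd :: int
  assumes "d = of_int dd" "squarefree dd" "dd mod 4 = 2"
    and "algebraic_integer (elt p q 0 0)"
  obtains P Q :: int where "p = of_int P" "q = of_int Q"
proof -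
  have sgx: "algebraic_integer (elt p (-q) 0 0)"
    using sg_algebraic_integer[OF elt_in_K assms(4)] by simp
  have "elt p q 0 0 + elt p (-q) 0 0 = of_rat (2 * p)" by (simp add: elt_add rat_elt)
  hence "algebraic_integer (of_rat (2 * p))"
    using algebraic_integer_add_mult(1)[OF assms(4) sgx] by simp
  then obtain P where P: "2 * p = of_int P" by (rule algebraic_integer_of_rat)
  have "elt p q 0 0 * elt p (-q) 0 0 = of_rat (p * p - d * q * q)" by (simp add: elt_mult rat_elt)
  hence "algebraic_integer (of_rat (p * p - d * q * q))"
    using algebraic_integer_add_mult(2)[OF assms(4) sgx] by simp
  then obtain N where N: "p * p - d * q * q = of_int N" by (rule algebraic_integer_of_rat)
  have "of_int dd * (2 * q)\<^sup>2 = (2 * p) * (2 * p) - 4 * (p * p - d * q * q)"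
    by (simp add: assms(1) power2_eq_square algebra_simps)
  also have "\<dots> = of_int (P * P - 4 * N)" unfolding P N by simp
  finally have dq: "of_int dd * (2 * q)\<^sup>2 = (of_int (P * P - 4 * N) :: rat)" .
  have "2 * q \<in> \<int>" by (rule squarefree_mult_square_int[OF assms(2)]) (unfold dq, rule Ints_of_int)
  then obtain Q where Q: "2 * q = of_int Q" by (auto elim: Ints_cases)
  have "(of_int (dd * Q\<^sup>2) :: rat) = of_int (P * P - 4 * N)"
    using dq unfolding Q of_int_mult of_int_power .
  hence eq: "dd * Q\<^sup>2 = P * P - 4 * N" by (simp only: of_int_eq_iff)
  have "even dd" using assms(3) by presburger
  hence "even (P * P - 4 * N)" unfolding eq[symmetric] by simp
  hence "even P" by simp
  then obtain P' where P': "P = 2 * P'" by blast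
  define k where "k = dd div 4"
  have "dd = 4 * k + 2" using assms(3) unfolding k_def by presburger
  hence "(2 * k + 1) * Q\<^sup>2 = 2 * (P' * P' - N)" using eq unfolding P' by (simp add: algebra_simps)
  hence "even ((2 * k + 1) * Q\<^sup>2)" by (metis dvd_triv_left)
  hence "even Q" by simp
  then obtain Q' where Q': "Q = 2 * Q'" by blast
  show ?thesis
    by (rule that[of P' Q']) (use P Q in \<open>simp_all add: P' Q'\<close>)
qed

end

section \<open>Relative units\<close>

context cyclic_quartic
begin

definition R :: "complex set" where
  "R = {u \<in> U. u * sg (sg u) = 1 \<or> u * sg (sg u) = -1}"

text \<open>Packing both logarithms into one complex number turns \<open>sg\<close> on
  \<open>R\<close> into multiplication by -i, so the logarithmic image of \<open>R\<close> is a
  module over the Gaussian integers.\<close>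

definition lg :: "complex \<Rightarrow> complex" where
  "lg u = Complex (ln (norm u)) (ln (norm (sg u)))"

lemma U_K: "u \<in> U \<Longrightarrow> u \<in> K" and U_nz: "u \<in> U \<Longrightarrow> u \<noteq> 0"
  by (auto simp: U_iff)

lemma R_U: "u \<in> R \<Longrightarrow> u \<in> U" and R_K: "u \<in> R \<Longrightarrow> u \<in> K" and R_nz: "u \<in> R \<Longrightarrow> u \<noteq> 0"
  by (auto simp: R_def U_iff)

lemma R_mult: "u \<in> R \<Longrightarrow> v \<in> R \<Longrightarrow> u * v \<in> R"
proof -
  assume uv: "u \<in> R" "v \<in> R"
  have "u * v * sg (sg (u * v)) = (u * sg (sg u)) * (v * sg (sg v))"
    using uv by (simp add: sg_mult R_K sg_K algebra_simps)
  moreover have "(u * sg (sg u)) * (v * sg (sg v)) = 1 \<or> (u * sg (sg u)) * (v * sg (sg v)) = -1"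
    using uv unfolding R_def by (elim CollectE conjE disjE) simp_all
  ultimately have "u * v * sg (sg (u * v)) = 1 \<or> u * v * sg (sg (u * v)) = -1"
    by (simp only:)
  moreover have "u * v \<in> U" using uv U_mult unfolding R_def by blast
  ultimately show ?thesis unfolding R_def by blast
qed

lemma R_inverse: "u \<in> R \<Longrightarrow> inverse u \<in> R"
proof -
  assume u: "u \<in> R"
  have "inverse u * sg (sg (inverse u)) = inverse (u * sg (sg u))"
    using u by (simp add: sg_inverse R_K sg_K)
  moreover have "inverse (u * sg (sg u)) = 1 \<or> inverse (u * sg (sg u)) = -1"
    using u unfolding R_def by (auto simp del: inverse_mult_distrib)
  ultimately have "inverse u * sg (sg (inverse u)) = 1 \<or> inverse u * sg (sg (inverse u)) = -1"
    by (simp only:)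
  moreover have "inverse u \<in> U" using u U_inverse unfolding R_def by blast
  ultimately show ?thesis unfolding R_def by blast
qed

lemma R_1: "1 \<in> R"
  unfolding R_def by (simp add: U_1)

lemma R_minus: "u \<in> R \<Longrightarrow> - u \<in> R"
  unfolding R_def by (auto simp: U_minus sg_minus U_K sg_K)

lemma R_sg: "u \<in> R \<Longrightarrow> sg u \<in> R"
proof -
  assume u: "u \<in> R"
  have "sg u * sg (sg (sg u)) = sg (u * sg (sg u))" using u by (simp add: sg_mult R_K sg_K)
  moreover have "sg (- 1) = - 1" using sg_of_int[of "-1"] by simp
  ultimately show ?thesis using u sg_U[of u] unfolding R_def by auto
qed

lemma R_power_int: "u \<in> R \<Longrightarrow> u powi j \<in> R"
proof -
  assume u: "u \<in> R"
  have "v ^ k \<in> R" if "v \<in> R" for v k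
    by (induction k) (auto intro: R_1 R_mult that)
  thus ?thesis unfolding power_int_def using R_inverse u by auto
qed

lemma lg_mult: "u \<in> U \<Longrightarrow> v \<in> U \<Longrightarrow> lg (u * v) = lg u + lg v"
  unfolding lg_def by (rule complex_eqI) (simp_all add: U_K sg_mult norm_mult ln_mult U_nz sg_eq_0_iff)

lemma lg_1: "lg 1 = 0"
  unfolding lg_def by (rule complex_eqI) simp_all

lemma lg_inverse: "u \<in> U \<Longrightarrow> lg (inverse u) = - lg u"
  using lg_mult[of u "inverse u"] by (simp add: U_inverse U_nz lg_1 eq_neg_iff_add_eq_0 add.commute)

lemma lg_power_int: "u \<in> U \<Longrightarrow> lg (u powi j) = of_int j * lg u"
proof -
  assume u: "u \<in> U"
  have pow: "v ^ k \<in> U \<and> lg (v ^ k) = of_nat k * lg v" if "v \<in> U" for v k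
    by (induction k) (auto simp: U_1 lg_1 U_mult lg_mult that algebra_simps)
  show ?thesis
  proof (cases "j \<ge> 0")
    case True
    thus ?thesis using pow[OF u, of "nat j"] by (simp add: power_int_def)
  next
    case False
    thus ?thesis using pow[OF U_inverse[OF u], of "nat (- j)"] u
      by (simp add: power_int_def lg_inverse)
  qed
qed

text \<open>The relative norm has absolute value 1, so the logarithm at \<open>sg (sg u)\<close> is
  the negative of that at \<open>u\<close>.\<close>

lemma lg_sg: "u \<in> R \<Longrightarrow> lg (sg u) = - \<i> * lg u"
proof -
  assume u: "u \<in> R"
  have "norm (u * sg (sg u)) = 1" using u unfolding R_def by auto
  hence "norm (sg (sg u)) = inverse (norm u)"
    unfolding norm_mult by (metis inverse_unique)
  thus ?thesis unfolding lg_def using u by (intro complex_eqI) (simp_all add: ln_inverse R_nz)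
qed

text \<open>The exponent \<open>- y\<close> compensates for \<open>sg\<close> acting as -i rather
  than i.\<close>

lemma lg_combination:
  "u \<in> R \<Longrightarrow> lg (u powi x * sg u powi (- y)) = Complex (of_int x) (of_int y) * lg u"
  by (simp only: lg_mult lg_power_int lg_sg R_U R_sg U_power_int) (rule complex_eqI, simp_all)

lemma combination_R: "u \<in> R \<Longrightarrow> u powi x * sg u powi y \<in> R"
  by (intro R_mult R_power_int R_sg)

text \<open>A positive lower bound for the logarithms of non-trivial relative units suffices for the
  logarithmic lattice to be a cyclic module over the Gaussian integers: Euclidean division by an element of
  norm less than twice the infimum leaves no remainder.\<close>
lemma R_generator:
  assumes "B > 0" and bound: "\<And>u. u \<in> R \<Longrightarrow> u \<noteq> 1 \<Longrightarrow> u \<noteq> -1 \<Longrightarrow> (norm (lg u))\<^sup>2 > B"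
    and "u0 \<in> R" "u0 \<noteq> 1" "u0 \<noteq> -1"
  obtains \<mu> where "\<mu> \<in> R" "(norm (lg \<mu>))\<^sup>2 > B"
    "\<And>u. u \<in> R \<Longrightarrow> \<exists>p q. lg u = Complex (of_int p) (of_int q) * lg \<mu>"
proof -
  define S where "S = (\<lambda>u. (norm (lg u))\<^sup>2) ` (R - {1, -1})"
  have ne: "S \<noteq> {}" using assms(3-5) unfolding S_def by blast
  have lb: "x \<ge> B" if "x \<in> S" for x using that bound unfolding S_def by (auto intro: less_imp_le)
  have I: "Inf S \<ge> B" using ne lb by (rule cInf_greatest)
  have Il: "Inf S \<le> x" if "x \<in> S" for x
    using that lb by (intro cInf_lower) (auto intro!: bdd_belowI)
  have "Inf S < 2 * Inf S" using I assms(1) by simp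
  then obtain x where "x \<in> S" "x < 2 * Inf S" using cInf_lessD[OF ne] by blast
  then obtain \<mu> where \<mu>: "\<mu> \<in> R" "\<mu> \<noteq> 1" "\<mu> \<noteq> -1" "(norm (lg \<mu>))\<^sup>2 < 2 * Inf S" unfolding S_def by auto
  have \<mu>B: "(norm (lg \<mu>))\<^sup>2 > B" by (rule bound) fact+
  hence nz: "lg \<mu> \<noteq> 0" using assms(1) by auto
  have "\<exists>p q. lg u = Complex (of_int p) (of_int q) * lg \<mu>" if u: "u \<in> R" for u
  proof -
    define t where "t = lg u / lg \<mu>"
    define p where "p = round (Re t)"
    define q where "q = round (Im t)"
    define h where "h = \<mu> powi p * sg \<mu> powi (- q)"
    define v where "v = u * inverse h"
    have h: "h \<in> R" unfolding h_def using \<mu>(1) by (rule combination_R)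
    have v: "v \<in> R" unfolding v_def by (intro R_mult R_inverse u h)
    have "lg v = lg u - Complex (of_int p) (of_int q) * lg \<mu>"
      unfolding v_def using u h \<mu>(1)
      by (simp only: lg_mult lg_inverse U_inverse R_U) (simp add: h_def lg_combination)
    also have "\<dots> = (t - Complex (of_int p) (of_int q)) * lg \<mu>"
      using nz by (simp add: t_def algebra_simps)
    finally have lgv: "lg v = (t - Complex (of_int p) (of_int q)) * lg \<mu>" .
    have "\<bar>Re t - of_int p\<bar> \<le> 1/2" "\<bar>Im t - of_int q\<bar> \<le> 1/2"
      unfolding p_def q_def using of_int_round_abs_le by (metis abs_minus_commute)+
    hence "(Re t - of_int p)\<^sup>2 \<le> (1/2)\<^sup>2" "(Im t - of_int q)\<^sup>2 \<le> (1/2)\<^sup>2"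
      by (metis abs_ge_zero power2_abs power_mono)+
    hence "(norm (t - Complex (of_int p) (of_int q)))\<^sup>2 \<le> 1/2"
      by (simp add: cmod_power2) (simp add: power2_eq_square)
    hence "(norm (lg v))\<^sup>2 \<le> 1/2 * (norm (lg \<mu>))\<^sup>2"
      unfolding lgv norm_mult power_mult_distrib by (intro mult_right_mono) auto
    also have "\<dots> < Inf S" using \<mu>(4) by simp
    finally have "v = 1 \<or> v = -1" using Il[of "(norm (lg v))\<^sup>2"] v unfolding S_def by fastforce
    hence "u = h \<or> u = - h" using R_nz[OF h] unfolding v_def by (auto simp: field_simps)
    hence "lg u = lg h" using R_K[OF h] by (auto simp: lg_def sg_minus)
    thus ?thesis using lg_combination[OF \<mu>(1)] unfolding h_def by auto
  qed
  thus ?thesis using that \<mu>(1) \<mu>B by blast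
qed

text \<open>The quotient of \<open>u\<close> and \<open>v\<close> has logarithm 0, which the bound
  allows only for 1 and -1.\<close>

lemma lg_eq_iff:
  assumes "B > 0" and bound: "\<And>u. u \<in> R \<Longrightarrow> u \<noteq> 1 \<Longrightarrow> u \<noteq> -1 \<Longrightarrow> (norm (lg u))\<^sup>2 > B"
    and "u \<in> R" "v \<in> R" "lg u = lg v"
  shows "u = v \<or> u = - v"
proof -
  have "u * inverse v \<in> R" by (intro R_mult R_inverse assms)
  moreover have "lg (u * inverse v) = 0" using assms(3-5) by (simp add: lg_mult lg_inverse U_inverse R_U)
  ultimately have "u * inverse v = 1 \<or> u * inverse v = -1"
    using bound[of "u * inverse v"] assms(1) by fastforce
  thus ?thesis using R_nz[OF assms(4)] by (auto simp: field_simps)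
qed

end

section \<open>The family of quartic fields\<close>

text \<open>Since a^2 + b^2 = d, the two radicands multiply to (c a w)^2. Any square root
  \<open>e\<close> of the first can thus be taken, \<open>f\<close> is defined by e f = c a w, and
  the other relations follow after multiplication by \<open>e\<close> or its square.\<close>

lemma cyclic_quartic_exists:
  fixes a b c d :: rat and w :: complex
  assumes w: "w * w = of_rat d" and abd: "a\<^sup>2 + b\<^sup>2 = d"
    and "a \<noteq> 0" "c \<noteq> 0" and nsq: "\<And>q. q\<^sup>2 \<noteq> d"
  obtains e f where "cyclic_quartic a b c d w e f"
proof -
  define A B C D where "A = complex_of_rat a" "B = complex_of_rat b" "C = complex_of_rat c" "D = complex_of_rat d"
  note defs = this
  have "d \<noteq> 0" using nsq[of 0] by auto
  have nz: "A \<noteq> 0" "C \<noteq> 0" "w \<noteq> 0" using assms(3,4) w \<open>d \<noteq> 0\<close> by (auto simp: defs)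
  have D: "D = A * A + B * B" unfolding defs by (simp add: power2_eq_square of_rat_add of_rat_mult flip: abd)
  have wD: "w * w = D" using w unfolding defs .
  define e where "e = csqrt (C * (D + B * w))"
  have e2: "e * e = C * (D + B * w)" unfolding e_def by (metis power2_csqrt power2_eq_square)
  have norm: "C * (D + B * w) * (C * (D - B * w)) = (C * A * w) * (C * A * w)"
  proof -
    have "C * (D + B * w) * (C * (D - B * w)) = C * C * (D * D - B * B * (w * w))"
      by (simp add: algebra_simps)
    also have "\<dots> = C * C * (A * A * (w * w))" unfolding wD D by (simp add: algebra_simps)
    finally show ?thesis by (simp add: algebra_simps)
  qed
  have "e * e \<noteq> 0" using norm nz e2 by auto
  hence e0: "e \<noteq> 0" by auto
  define f where "f = C * A * w / e"
  have ef: "e * f = C * A * w" using e0 by (simp add: f_def)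
  have "(e * e) * (f * f) = (e * f) * (e * f)" by (simp add: algebra_simps)
  also have "\<dots> = (e * e) * (C * (D - B * w))" unfolding ef e2 norm ..
  finally have ff: "f * f = C * (D - B * w)" using e0 by simp
  have "e * (w * e) = w * (e * e)" by (simp add: algebra_simps)
  also have "\<dots> = C * ((w * w) * B + D * w)" unfolding e2 by (simp add: algebra_simps)
  also have "\<dots> = A * (e * f) + B * (e * e)" unfolding e2 ef wD unfolding D by (simp add: algebra_simps)
  also have "\<dots> = e * (A * f + B * e)" by (simp add: algebra_simps)
  finally have we: "w * e = A * f + B * e" using e0 by simp
  have "e * (w * f) = w * (e * f)" by (simp add: algebra_simps)
  also have "\<dots> = C * A * (w * w)" unfolding ef by (simp add: algebra_simps)
  also have "\<dots> = A * (e * e) - B * (e * f)" unfolding e2 ef wD by (simp add: algebra_simps)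
  also have "\<dots> = e * (A * e - B * f)" by (simp add: algebra_simps)
  finally have wf: "w * f = A * e - B * f" using e0 by simp
  have "cyclic_quartic a b c d w e f"
    by unfold_locales
      (use w e2 ff ef we wf abd assms(3,4) nsq in \<open>auto simp: defs\<close>)
  thus ?thesis by (rule that)
qed

lemma int_square_ne_square_add_2: "k\<^sup>2 \<noteq> s\<^sup>2 + (2::int)"
proof
  assume "k\<^sup>2 = s\<^sup>2 + 2"
  hence eq: "\<bar>k\<bar>\<^sup>2 = \<bar>s\<bar>\<^sup>2 + 2" by simp
  hence "\<bar>s\<bar> < \<bar>k\<bar>" by (metis abs_ge_zero less_add_same_cancel1 power_less_imp_less_base zero_less_numeral)
  hence "(\<bar>s\<bar> + 1)\<^sup>2 \<le> \<bar>k\<bar>\<^sup>2" by (intro power_mono) auto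
  hence "2 * \<bar>s\<bar> \<le> 1" using eq by (simp add: power2_eq_square algebra_simps)
  hence "s = 0" by simp
  hence k2: "\<bar>k\<bar> * \<bar>k\<bar> = 2" using eq by (simp add: power2_eq_square)
  have "\<bar>k\<bar> \<ge> 2 \<Longrightarrow> \<bar>k\<bar> * \<bar>k\<bar> \<ge> 2 * 2" by (intro mult_mono) auto
  hence "\<bar>k\<bar> < 2" using k2 by linarith
  hence "\<bar>k\<bar> = 0 \<or> \<bar>k\<bar> = 1" by linarith
  hence "\<bar>k\<bar> * \<bar>k\<bar> = 0 \<or> \<bar>k\<bar> * \<bar>k\<bar> = 1" by (metis mult_1 mult_zero_left)
  thus False using k2 by linarith
qed

lemma rat_square_ne_square_add_2: "q\<^sup>2 \<noteq> (of_int (s\<^sup>2 + 2) :: rat)"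
proof
  assume eq: "q\<^sup>2 = of_int (s\<^sup>2 + 2)"
  have "of_int 1 * q\<^sup>2 \<in> \<int>" unfolding eq of_int_1 mult_1 by (rule Ints_of_int)
  hence "q \<in> \<int>" using squarefree_mult_square_int[of 1 q] by simp
  then obtain k where "q = of_int k" by (auto elim: Ints_cases)
  hence "(of_int (k\<^sup>2) :: rat) = of_int (s\<^sup>2 + 2)" using eq by simp
  thus False using int_square_ne_square_add_2 unfolding of_int_eq_iff by blast
qed

text \<open>With p = s^3 - s^2 + 2 s - 1 and g = s^2 - s + 1, the quartic has the factor z^2 + 2 (p
  + g w) z - (s^2 + 1 + s w) over Q(w). A quarter of its discriminant is (p + g w)^2 + s^2 + 1 + s w
  = c d + c b w, which dictates c = 2 g^2 and c b = 2 p g + s; then c a = m solves a^2 + b^2 =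
  d.\<close>

locale quartic_family = cyclic_quartic a b c d w e f
  for a b c d :: rat and w e f :: complex +
  fixes s m :: int
  assumes smeq: "3 * s\<^sup>2 - 4 * s + 4 = m\<^sup>2"
    and d_eq: "d = of_int (s\<^sup>2 + 2)"
    and c_eq: "c = of_int (2 * (s\<^sup>2 - s + 1)\<^sup>2)"
    and ca: "c * a = of_int m"
    and cb: "c * b = of_int (2 * (s^3 - s\<^sup>2 + 2*s - 1) * (s\<^sup>2 - s + 1) + s)"
    and w_eq: "w = of_real (sqrt (of_int (s\<^sup>2 + 2)))"

lemma quartic_family_exists:
  fixes s m :: int
  assumes "3 * s\<^sup>2 - 4 * s + 4 = m\<^sup>2"
  obtains a b c d w e f where "quartic_family a b c d w e f s m"
proof -
  define g where "g = s\<^sup>2 - s + 1"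
  have "4 * g = (2 * s - 1)\<^sup>2 + 3" unfolding g_def by (simp add: power2_eq_square algebra_simps)
  hence g0: "g > 0" using zero_le_power2[of "2*s-1"] by linarith
  \<comment> \<open>Completing the square shows \<open>m\<close> to be nonzero, which gives a
    \<noteq> 0.\<close>
  have "3 * m\<^sup>2 = (3 * s - 2)\<^sup>2 + 8" unfolding assms[symmetric] by (simp add: power2_eq_square algebra_simps)
  hence "3 * m\<^sup>2 \<noteq> 0" using zero_le_power2[of "3*s-2"] by linarith
  hence m0: "m \<noteq> 0" by auto
  define c where "c = (of_int (2 * g\<^sup>2) :: rat)"
  define B where "B = 2 * (s^3 - s\<^sup>2 + 2*s - 1) * g + s"
  define a where "a = of_int m / c"
  define b where "b = of_int B / c"
  define d where "d = (of_int (s\<^sup>2 + 2) :: rat)"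
  define w where "w = complex_of_real (sqrt (of_int (s\<^sup>2 + 2)))"
  have c0: "c \<noteq> 0" using g0 by (simp add: c_def)
  \<comment> \<open>Here the hypothesis on \<open>s\<close> enters: the conjugate radicands have
    product d m^2, \<open>d\<close> times a square, which is the criterion for a cyclic
    group.\<close>
  have int_id: "m\<^sup>2 + B\<^sup>2 = (s\<^sup>2 + 2) * (2 * g\<^sup>2)\<^sup>2"
    unfolding assms[symmetric] B_def g_def by (simp add: power2_eq_square power3_eq_cube algebra_simps)
  have "a\<^sup>2 + b\<^sup>2 = of_int (m\<^sup>2 + B\<^sup>2) / c\<^sup>2" by (simp add: a_def b_def power_divide add_divide_distrib)
  also have "\<dots> = d" unfolding int_id using c0 by (simp add: d_def c_def)
  finally have abd: "a\<^sup>2 + b\<^sup>2 = d" .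
  have "sqrt (of_int (s\<^sup>2 + 2)) * sqrt (of_int (s\<^sup>2 + 2)) = real_of_int (s\<^sup>2 + 2)" by simp
  hence "w * w = of_real (of_int (s\<^sup>2 + 2))" unfolding w_def of_real_mult[symmetric] by (simp only:)
  also have "\<dots> = of_rat d" unfolding d_def of_rat_of_int_eq of_real_of_int_eq ..
  finally have ww: "w * w = of_rat d" .
  have nsq: "q\<^sup>2 \<noteq> d" for q unfolding d_def by (rule rat_square_ne_square_add_2)
  have a0: "a \<noteq> 0" using m0 c0 by (simp add: a_def)
  obtain e f where "cyclic_quartic a b c d w e f"
    using cyclic_quartic_exists[OF ww abd a0 c0 nsq] by blast
  hence "quartic_family a b c d w e f s m"
    unfolding quartic_family_def quartic_family_axioms_def
    using assms c0 by (auto simp: d_def c_def a_def b_def w_def B_def g_def)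
  thus ?thesis by (rule that)
qed

section \<open>Roots and splitting field of the quartic\<close>

context quartic_family
begin

definition g :: int where "g = s\<^sup>2 - s + 1"
definition p :: int where "p = s^3 - s\<^sup>2 + 2*s - 1"

definition \<epsilon> :: complex where "\<epsilon> = elt (- of_int p) (- of_int g) 1 0"

lemma g_pos: "g > 0"
proof -
  have "4 * g = (2 * s - 1)\<^sup>2 + 3" unfolding g_def by (simp add: power2_eq_square algebra_simps)
  thus ?thesis using zero_le_power2[of "2*s-1"] by linarith
qed

lemma ww_int: "w * w = of_int (s\<^sup>2 + 2)"
  using ww unfolding d_eq of_rat_of_int_eq .

lemma ee_int: "e * e = (of_int p + of_int g * w)\<^sup>2 + of_int (s\<^sup>2 + 1) + of_int s * w"
proof -
  have id: "2 * g\<^sup>2 * (s\<^sup>2 + 2) = p\<^sup>2 + g\<^sup>2 * (s\<^sup>2 + 2) + (s\<^sup>2 + 1)"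
    unfolding g_def p_def by (simp add: power2_eq_square power3_eq_cube algebra_simps)
  have "e * e = of_rat (c * d) + of_rat (c * b) * w"
    unfolding ee by (simp add: of_rat_mult algebra_simps)
  also have "c * d = of_int (2 * g\<^sup>2 * (s\<^sup>2 + 2))" unfolding c_eq d_eq g_def by simp
  also have "c * b = of_int (2 * p * g + s)" unfolding cb g_def p_def by simp
  finally have "e * e = of_int (2 * g\<^sup>2 * (s\<^sup>2 + 2)) + of_int (2 * p * g + s) * w"
    unfolding of_rat_of_int_eq .
  also have "\<dots> = of_int p * of_int p + of_int g * of_int g * (w * w) + of_int (s\<^sup>2 + 1) + of_int (2 * p * g + s) * w"
    unfolding id ww_int by (simp add: power2_eq_square)
  finally show ?thesis by (simp add: power2_eq_square algebra_simps)
qed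

lemma ff_int: "f * f = (of_int p - of_int g * w)\<^sup>2 + of_int (s\<^sup>2 + 1) - of_int s * w"
proof -
  have "sg (e * e) = sg ((of_int p + of_int g * w) * (of_int p + of_int g * w) + of_int (s\<^sup>2 + 1) + of_int s * w)"
    unfolding ee_int power2_eq_square ..
  thus ?thesis
    by (simp add: sg_mult sg_add KK K_add K_mult K_of_int power2_eq_square del: of_int_add of_int_mult)
qed

lemma sg_eps: "sg \<epsilon> = elt (- of_int p) (of_int g) 0 1"
  and sg2_eps: "sg (sg \<epsilon>) = elt (- of_int p) (- of_int g) (- 1) 0"
  and sg3_eps: "sg (sg (sg \<epsilon>)) = elt (- of_int p) (of_int g) 0 (- 1)"
  by (simp_all add: \<epsilon>_def)

text \<open>The roots \<open>\<epsilon>\<close> and \<open>sg (sg \<epsilon>)\<close> are -(p + g w)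
  + e and -(p + g w) - e, giving a quadratic A + B w; the other two give A - B w. The product A^2 -
  B^2 w^2 has coefficients in \<open>s\<close> alone.\<close>

lemma poly_F_poly:
  "poly (F_poly s) z = (z - \<epsilon>) * (z - sg (sg \<epsilon>)) * ((z - sg \<epsilon>) * (z - sg (sg (sg \<epsilon>))))"
proof -
  define P G S where "P = complex_of_int p" and "G = complex_of_int g" and "S = complex_of_int s"
  have P: "P = S*S*S - S*S + 2*S - 1" and G: "G = S*S - S + 1"
    by (simp_all add: P_def G_def S_def p_def g_def power2_eq_square power3_eq_cube)
  have w2: "w * w = S * S + 2" unfolding ww_int S_def by (simp add: power2_eq_square)
  have e2: "e * e = (P + G * w)\<^sup>2 + S * S + 1 + S * w"
    unfolding ee_int P_def G_def S_def by (simp add: power2_eq_square)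
  have f2: "f * f = (P - G * w)\<^sup>2 + S * S + 1 - S * w"
    unfolding ff_int P_def G_def S_def by (simp add: power2_eq_square)
  have "(z - \<epsilon>) * (z - sg (sg \<epsilon>)) = (z + P + G * w)\<^sup>2 - e * e"
    unfolding sg2_eps unfolding \<epsilon>_def elt_def P_def G_def by (simp add: of_rat_minus power2_eq_square algebra_simps)
  also have "\<dots> = (z * z + 2 * P * z - S * S - 1) + (2 * G * z - S) * w"
    unfolding e2 by (simp add: power2_eq_square algebra_simps)
  finally have 1: "(z - \<epsilon>) * (z - sg (sg \<epsilon>)) = (z * z + 2 * P * z - S * S - 1) + (2 * G * z - S) * w" .
  have "(z - sg \<epsilon>) * (z - sg (sg (sg \<epsilon>))) = (z + P - G * w)\<^sup>2 - f * f"
    unfolding sg3_eps unfolding sg_eps elt_def P_def G_def by (simp add: of_rat_minus power2_eq_square algebra_simps)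
  also have "\<dots> = (z * z + 2 * P * z - S * S - 1) - (2 * G * z - S) * w"
    unfolding f2 by (simp add: power2_eq_square algebra_simps)
  finally have 2: "(z - sg \<epsilon>) * (z - sg (sg (sg \<epsilon>))) = (z * z + 2 * P * z - S * S - 1) - (2 * G * z - S) * w" .
  have "(z - \<epsilon>) * (z - sg (sg \<epsilon>)) * ((z - sg \<epsilon>) * (z - sg (sg (sg \<epsilon>)))) =
      (z * z + 2 * P * z - S * S - 1)\<^sup>2 - (2 * G * z - S)\<^sup>2 * (w * w)"
    unfolding 1 2 by (simp add: power2_eq_square algebra_simps)
  also have "\<dots> = z^4 + (4*S^3 - 4*S^2 + 8*S - 4)*z^3 + (-6*S^2 - 6)*z^2 + 4*z + 1"
    unfolding w2 unfolding P G by (simp add: power2_eq_square power3_eq_cube power4_eq_xxxx algebra_simps)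
  also have "\<dots> = poly (F_poly s) z"
    unfolding F_poly_def S_def
    by (simp add: map_poly_pCons power2_eq_square power3_eq_cube power4_eq_xxxx algebra_simps)
  finally show ?thesis ..
qed

lemma F_roots_eq: "F_roots s = {\<epsilon>, sg \<epsilon>, sg (sg \<epsilon>), sg (sg (sg \<epsilon>))}"
  unfolding F_roots_def poly_F_poly by auto

lemma eps_K: "\<epsilon> \<in> K"
  by (simp add: \<epsilon>_def)

lemma splitting_field_eq: "splitting_field (F_poly s) = K"
proof
  have roots: "{z. poly (F_poly s) z = 0} = {\<epsilon>, sg \<epsilon>, sg (sg \<epsilon>), sg (sg (sg \<epsilon>))}"
    using F_roots_eq unfolding F_roots_def .
  show "splitting_field (F_poly s) \<subseteq> K"
    unfolding splitting_field_def roots using K_is_subfield eps_K sg_K by (intro Inter_lower) auto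
  show "K \<subseteq> splitting_field (F_poly s)"
    unfolding splitting_field_def roots
  proof (rule Inter_greatest)
    fix L assume "L \<in> {L. is_subfield L \<and> {\<epsilon>, sg \<epsilon>, sg (sg \<epsilon>), sg (sg (sg \<epsilon>))} \<subseteq> L}"
    hence sub: "is_subfield L" and r: "\<epsilon> \<in> L" "sg \<epsilon> \<in> L" "sg (sg \<epsilon>) \<in> L" "sg (sg (sg \<epsilon>)) \<in> L" by auto
    have add: "x + y \<in> L" and mult: "x * y \<in> L" and diff: "x - y \<in> L" if "x \<in> L" "y \<in> L" for x y
      using sub that unfolding is_subfield_def by (auto simp only: diff_conv_add_uminus)
    have rat: "of_rat q \<in> L" for q by (rule subfield_of_rat[OF sub])
    have "e = of_rat (1/2) * (\<epsilon> - sg (sg \<epsilon>))"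
      unfolding sg2_eps unfolding \<epsilon>_def elt_diff by (simp add: elt_def of_rat_divide)
    hence "e \<in> L" using r by (metis mult diff rat)
    moreover have "f = of_rat (1/2) * (sg \<epsilon> - sg (sg (sg \<epsilon>)))"
      unfolding sg3_eps unfolding sg_eps elt_diff by (simp add: elt_def of_rat_divide)
    hence "f \<in> L" using r by (metis mult diff rat)
    \<comment> \<open>The traces of \<open>sg \<epsilon>\<close> and \<open>\<epsilon>\<close> down
      to Q(w) differ by 4 g w, and g > 0.\<close>
    moreover have "w = of_rat (1 / (4 * of_int g)) * ((sg \<epsilon> + sg (sg (sg \<epsilon>))) - (\<epsilon> + sg (sg \<epsilon>)))"
      unfolding sg3_eps unfolding sg2_eps unfolding sg_eps unfolding \<epsilon>_def elt_diff elt_add using g_pos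
      by (simp add: elt_def of_rat_divide of_rat_mult of_rat_add)
    hence "w \<in> L" using r by (metis mult diff add rat)
    ultimately show "K \<subseteq> L" using K_subset_subfield[OF sub] by blast
  qed
qed

lemma cd: "c * d = of_int (2 * g\<^sup>2 * (s\<^sup>2 + 2))"
  unfolding c_eq d_eq g_def by simp

lemma relative_norm_eps: "\<epsilon> * sg (sg \<epsilon>) = elt (of_int (- (s\<^sup>2 + 1))) (of_int (- s)) 0 0"
proof -
  have 1: "p\<^sup>2 + (s\<^sup>2 + 2) * g\<^sup>2 - 2 * g\<^sup>2 * (s\<^sup>2 + 2) = - (s\<^sup>2 + 1)"
    unfolding g_def p_def by (simp add: power2_eq_square power3_eq_cube algebra_simps)
  have "\<epsilon> * sg (sg \<epsilon>) = elt (of_int p * of_int p + d * of_int g * of_int g - c * d) (2 * of_int p * of_int g - c * b) 0 0"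
    unfolding sg2_eps unfolding \<epsilon>_def elt_mult by (simp add: algebra_simps)
  also have "of_int p * of_int p + d * of_int g * of_int g - c * d = of_int (- (s\<^sup>2 + 1))"
    unfolding cd unfolding d_eq 1[symmetric] by (simp add: power2_eq_square)
  also have "2 * of_int p * of_int g - c * b = of_int (- s)"
    unfolding cb by (simp add: p_def g_def)
  finally show ?thesis .
qed

definition \<rho> :: complex where "\<rho> = \<epsilon> * sg \<epsilon>"

lemma rho_K: "\<rho> \<in> K" unfolding \<rho>_def by (intro K_mult sg_K eps_K)

text \<open>The part of \<open>\<rho>\<close> in Q(w) is p^2 - g^2 d + e f, where p^2 - g^2 d =
  -(s^2 + 1) and e f = m w; the trace doubles it. As m \<noteq> 0, \<open>\<rho>\<close> is
  irrational.\<close>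

lemma trace_rho: "\<rho> + sg (sg \<rho>) = elt (of_int (- 2 * (s\<^sup>2 + 1))) (of_int (2 * m)) 0 0"
  and rho_ne: "\<rho> \<noteq> 1" "\<rho> \<noteq> -1"
proof -
  have 1: "p\<^sup>2 - (s\<^sup>2 + 2) * g\<^sup>2 = - (s\<^sup>2 + 1)"
    unfolding g_def p_def by (simp add: power2_eq_square power3_eq_cube algebra_simps)
  have rho: "\<exists>x y. \<rho> = elt (of_int p * of_int p - d * of_int g * of_int g) (c * a) x y"
    unfolding \<rho>_def sg_eps unfolding \<epsilon>_def elt_mult by (simp add: elt_inject)
  have "of_int p * of_int p - d * of_int g * of_int g = of_int (- (s\<^sup>2 + 1))"
    unfolding d_eq 1[symmetric] by (simp add: power2_eq_square)
  with rho obtain x y where rho: "\<rho> = elt (of_int (- (s\<^sup>2 + 1))) (of_int m) x y"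
    unfolding ca by auto
  show "\<rho> + sg (sg \<rho>) = elt (of_int (- 2 * (s\<^sup>2 + 1))) (of_int (2 * m)) 0 0"
    unfolding rho by (simp add: elt_add elt_inject)
  have "m \<noteq> 0" using ca a0 c0 by auto
  thus "\<rho> \<noteq> 1" "\<rho> \<noteq> -1" unfolding rho one_elt elt_minus by (auto simp: elt_inject)
qed

end

text \<open>An odd \<open>s\<close> makes the left side 3 modulo 4. For s = 2 r and m = 2 n the
  equation becomes 3 r^2 - 2 r + 1 = n^2, whose left side is 2 modulo 4 for odd r.\<close>

lemma multiple_of_4_of_square:
  fixes s m :: int
  assumes "3 * s\<^sup>2 - 4 * s + 4 = m\<^sup>2"
  shows "4 dvd s"
proof -
  have "even s"
  proof (rule ccontr)
    assume "odd s"
    then obtain k where k: "s = 2 * k + 1" by (rule oddE)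
    hence "odd (m\<^sup>2)" unfolding assms[symmetric] by simp
    hence "odd m" by simp
    then obtain l where l: "m = 2 * l + 1" by (rule oddE)
    have "2 * (2 * (3 * k\<^sup>2 + k - l\<^sup>2 - l)) = - 2" using assms unfolding k l by (simp add: power2_eq_square algebra_simps)
    thus False by presburger
  qed
  then obtain r where r: "s = 2 * r" by blast
  hence "even (m\<^sup>2)" unfolding assms[symmetric] by simp
  hence "even m" by simp
  then obtain n where n: "m = 2 * n" by blast
  have eq: "3 * r\<^sup>2 - 2 * r + 1 = n\<^sup>2" using assms unfolding r n by (simp add: power2_eq_square)
  have "even r"
  proof (rule ccontr)
    assume "odd r"
    then obtain k where k: "r = 2 * k + 1" by (rule oddE)
    hence "even (n\<^sup>2)" unfolding eq[symmetric] by simp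
    hence "even n" by simp
    then obtain l where l: "n = 2 * l" by blast
    have "4 * (3 * k\<^sup>2 + 2 * k - l\<^sup>2) = - 2" using eq unfolding k l by (simp add: power2_eq_square algebra_simps)
    thus False by presburger
  qed
  thus ?thesis unfolding r by (elim evenE) auto
qed

section \<open>Units when s^2 + 2 is squarefree\<close>

locale squarefree_family = quartic_family a b c d w e f s m
  for a b c d :: rat and w e f :: complex and s m :: int +
  assumes sqf: "squarefree (s\<^sup>2 + 2)" and s0: "s \<noteq> 0"
begin

lemma s_dvd: "4 dvd s"
  using multiple_of_4_of_square smeq .

text \<open>The values 4 and -4 are excluded because they give s^2 + 2 = 18 = 3^2 * 2. The constant
  8 enters the estimate \<open>lg_rho_bound\<close>.\<close>

lemma s_ge: "\<bar>s\<bar> \<ge> 8"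
proof -
  obtain k where k: "s = 4 * k" using s_dvd by blast
  have "\<bar>k\<bar> \<noteq> 1"
  proof
    assume "\<bar>k\<bar> = 1"
    hence "k * k = 1" by (metis abs_mult_self_eq mult_1)
    hence "s\<^sup>2 + 2 = 3\<^sup>2 * 2" unfolding k by (simp add: power2_eq_square)
    hence "is_unit (3::int)" using sqf unfolding squarefree_def by (metis dvd_triv_left)
    thus False by simp
  qed
  moreover have "k \<noteq> 0" using s0 k by simp
  ultimately show ?thesis unfolding k by (simp add: abs_mult)
qed

lemma d_mod: "(s\<^sup>2 + 2) mod 4 = 2"
proof -
  obtain k where "s = 4 * k" using s_dvd by blast
  hence "s\<^sup>2 + 2 = 4 * (4 * k\<^sup>2) + 2" by (simp add: power2_eq_square)
  thus ?thesis by presburger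
qed

lemmas quadratic_integer = integer_in_quadratic_subfield[OF d_eq sqf d_mod]

lemma elt_of_int: "elt (of_int x) (of_int y) 0 0 = of_int x + of_int y * w"
  by (simp add: elt_def)

definition \<nu> :: complex where "\<nu> = \<epsilon> * sg (sg \<epsilon>)"

lemma nu_eq: "\<nu> = - of_real (pell_unit s)"
  unfolding \<nu>_def relative_norm_eps elt_of_int pell_unit_def unfolding w_eq by simp

lemma nu_mult_sg_nu: "\<nu> * sg \<nu> = 1"
proof -
  have "(of_int (s\<^sup>2 + 1))\<^sup>2 - d * (of_int s)\<^sup>2 = 1"
    unfolding d_eq by (simp add: power2_eq_square algebra_simps)
  hence "\<nu> * sg \<nu> = elt 1 0 0 0"
    unfolding \<nu>_def relative_norm_eps
    by (simp add: elt_mult elt_inject power2_eq_square algebra_simps)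
  thus ?thesis by (simp add: one_elt)
qed

text \<open>The norm of \<open>\<epsilon>\<close> is \<open>\<nu> * sg \<nu>\<close> = 1, so its
  inverse is the product of the other three conjugates.\<close>

lemma eps_U: "\<epsilon> \<in> U"
proof -
  have "poly (F_poly s) \<epsilon> = 0" unfolding poly_F_poly by simp
  hence int: "algebraic_integer \<epsilon>" unfolding algebraic_integer_def F_poly_def
    by (intro exI[of _ "[:1, 4, -6*s^2 - 6, 4*s^3 - 4*s^2 + 8*s - 4, 1:]"]) simp
  have "\<epsilon> * (sg (sg \<epsilon>) * (sg \<epsilon> * sg (sg (sg \<epsilon>)))) = 1"
    using nu_mult_sg_nu unfolding \<nu>_def by (simp add: sg_mult eps_K sg_K mult.assoc)
  moreover from this have "inverse \<epsilon> = sg (sg \<epsilon>) * (sg \<epsilon> * sg (sg (sg \<epsilon>)))" by (rule inverse_unique)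
  ultimately show ?thesis
    unfolding U_iff using int by (auto simp: eps_K sg_K intro!: algebraic_integer_add_mult(2) sg_algebraic_integer)
qed

lemma rho_R: "\<rho> \<in> R"
proof -
  have "\<rho> * sg (sg \<rho>) = \<nu> * sg \<nu>"
    unfolding \<rho>_def \<nu>_def by (simp add: sg_mult eps_K sg_K mult_ac)
  thus ?thesis unfolding R_def nu_mult_sg_nu by (simp add: \<rho>_def U_mult sg_U eps_U)
qed

text \<open>Integers of Q(w) lie in Z[w], and a unit among them has norm 1 or -1, so it is a
  solution in the sense of \<open>pell\<close>; signs absorb the difference between
  \<open>\<nu>\<close> and \<open>pell_unit s\<close>.\<close>

lemma unit_quadratic:
  assumes "elt x y 0 0 \<in> U"
  obtains j where "elt x y 0 0 = \<nu> powi j \<or> elt x y 0 0 = - (\<nu> powi j)"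
proof -
  obtain P Q where PQ: "x = of_int P" "y = of_int Q"
    using quadratic_integer assms unfolding U_iff by blast
  define n where "n = P\<^sup>2 - (s\<^sup>2 + 2) * Q\<^sup>2"
  have "elt x y 0 0 * sg (elt x y 0 0) = of_rat (of_int n)"
    unfolding PQ n_def rat_elt by (simp add: elt_mult elt_inject d_eq power2_eq_square)
  hence nU: "of_rat (of_int n) \<in> U" by (metis U_mult sg_U assms)
  hence "n \<noteq> 0" by (auto dest: U_nz)
  have "algebraic_integer (of_rat (inverse (of_int n)))" using nU unfolding U_iff of_rat_inverse by blast
  then obtain k where "inverse (of_int n) = (of_int k :: rat)" by (rule algebraic_integer_of_rat)
  hence "(of_int (n * k) :: rat) = 1" using \<open>n \<noteq> 0\<close> by (simp add: field_simps)
  hence "n * k = 1" by (metis of_int_eq_1_iff)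
  hence n: "\<bar>n\<bar> = 1" by (metis abs_zmult_eq_1 abs_one)
  define \<theta> where "\<theta> = of_int P + of_int Q * sqrt (of_int (s\<^sup>2 + 2))"
  have "pell (s\<^sup>2 + 2) \<theta>" unfolding pell_def \<theta>_def using n unfolding n_def by blast
  then obtain j where j: "\<bar>\<theta>\<bar> = pell_unit s powi j" by (rule pell_fundamental[OF s0])
  have "elt x y 0 0 = of_real \<theta>" unfolding elt_def PQ \<theta>_def unfolding w_eq by simp
  hence "elt x y 0 0 = of_real (pell_unit s) powi j \<or> elt x y 0 0 = - (of_real (pell_unit s) powi j)"
    unfolding of_real_power_int[symmetric] j[symmetric] by (auto simp: abs_if)
  moreover have "\<nu> powi j = of_real (pell_unit s) powi j \<or> \<nu> powi j = - (of_real (pell_unit s) powi j)"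
    unfolding nu_eq by (simp add: power_int_minus_left)
  ultimately have "elt x y 0 0 = \<nu> powi j \<or> elt x y 0 0 = - (\<nu> powi j)" by auto
  thus ?thesis by (rule that)
qed

text \<open>The relative norm of \<open>u\<close> is \<nu>^j up to sign and \<open>\<nu>\<close> is
  that of \<open>\<epsilon>\<close>, so dividing \<open>u\<close> by \<epsilon>^j leaves a relative
  unit.\<close>

lemma unit_decomposition:
  assumes u: "u \<in> U"
  obtains j v where "v \<in> R" "u = \<epsilon> powi j * v"
proof -
  obtain x0 x1 x2 x3 where x: "u = elt x0 x1 x2 x3" using U_K[OF u] by (rule K_cases)
  have "\<exists>x y. u * sg (sg u) = elt x y 0 0" unfolding x by (simp add: elt_mult elt_inject)
  then obtain x y where xy: "u * sg (sg u) = elt x y 0 0" by blast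
  have "u * sg (sg u) \<in> U" by (intro U_mult sg_U u)
  then obtain j where j: "u * sg (sg u) = \<nu> powi j \<or> u * sg (sg u) = - (\<nu> powi j)"
    using unit_quadratic unfolding xy by blast
  define v where "v = u * \<epsilon> powi (- j)"
  have nz: "\<epsilon> \<noteq> 0" "\<nu> \<noteq> 0" using U_nz[OF eps_U] nu_mult_sg_nu by auto
  have vU: "v \<in> U" unfolding v_def by (intro U_mult U_power_int u eps_U)
  have "v * sg (sg v) = (u * sg (sg u)) * \<nu> powi (- j)"
    unfolding v_def \<nu>_def using u eps_U
    by (simp add: sg_mult sg_power_int U_K sg_U U_power_int power_int_mult_distrib mult_ac)
  moreover have "\<nu> powi j * \<nu> powi (- j) = 1" using nz by (simp add: power_int_minus)
  ultimately have "v * sg (sg v) = 1 \<or> v * sg (sg v) = -1" using j by auto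
  hence "v \<in> R" using vU unfolding R_def by blast
  moreover have "u = \<epsilon> powi j * v" unfolding v_def using nz by (simp add: power_int_minus)
  ultimately show ?thesis using that by blast
qed

section \<open>Estimates for the logarithmic lattice\<close>

lemma norm_w: "norm w = sqrt (\<bar>real_of_int s\<bar>\<^sup>2 + 2)"
  unfolding w_eq by simp

lemma norm_sg2: "u \<in> R \<Longrightarrow> norm (sg (sg u)) = inverse (norm u)"
proof -
  assume "u \<in> R"
  hence "norm (u * sg (sg u)) = 1" unfolding R_def by auto
  thus ?thesis unfolding norm_mult by (metis inverse_unique)
qed

text \<open>The relative trace T = P + Q w and the difference V satisfy V^2 = T^2 - 4 \<delta>, and
  taking norms yields the equation of \<open>even_of_norm_equation\<close>. An even nonzero
  \<open>Q\<close> makes \<open>T\<close> and \<open>sg T\<close> far apart, which forces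
  \<open>u\<close> or \<open>sg u\<close> to be far from absolute value 1.\<close>

lemma lg_bound:
  assumes u: "u \<in> R" "u \<noteq> 1" "u \<noteq> -1"
  shows "(norm (lg u))\<^sup>2 > (ln (2 * \<bar>real_of_int s\<bar>))\<^sup>2"
proof -
  have uK: "u \<in> K" and uU: "u \<in> U" using u(1) R_K R_U by auto
  obtain \<delta> :: int where \<delta>: "u * sg (sg u) = of_int \<delta>" "\<delta> = 1 \<or> \<delta> = -1"
  proof -
    from u(1) have "u * sg (sg u) = of_int 1 \<or> u * sg (sg u) = of_int (-1)" unfolding R_def by simp
    thus thesis using that by blast
  qed
  obtain x0 x1 x2 x3 where x: "u = elt x0 x1 x2 x3" using uK by (rule K_cases)
  define T V where "T = u + sg (sg u)" and "V = u - sg (sg u)"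
  have int: "algebraic_integer u" "algebraic_integer (sg (sg u))" using uU sg_U unfolding U_iff by auto
  have TK: "T \<in> K" and VK: "V \<in> K" unfolding T_def V_def using uK by (auto intro: K_add K_diff sg_K)
  have Tx: "T = elt (2 * x0) (2 * x1) 0 0" unfolding T_def x by (simp add: elt_add)
  have "algebraic_integer T" unfolding T_def by (intro algebraic_integer_add_mult int)
  then obtain P Q where PQ: "2 * x0 = of_int P" "2 * x1 = of_int Q"
    using quadratic_integer[of "2*x0" "2*x1"] unfolding Tx by metis
  have T: "T = of_int P + of_int Q * w"
    unfolding Tx PQ elt_of_int ..
  have sgT: "sg T = of_int P - of_int Q * w"
    unfolding T by (simp add: sg_add sg_mult K_of_int K_mult KK)
  \<comment> \<open>V = 2 (x2 e + x3 f) and sg V = 2 (x2 f - x3 e), so the product involves only e f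
    and f^2 - e^2, both rational multiples of \<open>w\<close>.\<close>
  have "\<exists>y. V * sg V = elt 0 y 0 0"
    unfolding V_def x by (simp add: elt_diff elt_mult elt_inject algebra_simps) (metis diff_add_cancel)
  then obtain y where y: "V * sg V = elt 0 y 0 0" by blast
  have "algebraic_integer V" unfolding V_def by (intro algebraic_integer_diff int)
  hence "algebraic_integer (V * sg V)" by (intro algebraic_integer_add_mult sg_algebraic_integer VK)
  then obtain r where "y = of_int r" unfolding y by (rule quadratic_integer)
  hence r: "V * sg V = of_int r * w" unfolding y by (simp add: elt_def)
  have VT: "V * V = T * T - 4 * of_int \<delta>"
    unfolding V_def T_def \<delta>(1)[symmetric] by (simp add: algebra_simps)
  have "sg (V * V) = sg T * sg T - 4 * of_int \<delta>"
    unfolding VT using sg_of_int[of 4] K_of_int[of 4]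
    by (simp add: sg_diff sg_mult K_mult TK K_of_int)
  hence VT': "sg V * sg V = sg T * sg T - 4 * of_int \<delta>" by (simp add: sg_mult VK)
  have "(V * V) * (sg V * sg V) = (V * sg V) * (V * sg V)" by (simp add: mult_ac)
  hence "(T * T - 4 * of_int \<delta>) * (sg T * sg T - 4 * of_int \<delta>) = of_int r * of_int r * (w * w)"
    unfolding VT VT' r by (simp add: algebra_simps)
  moreover have "(T * T - 4 * of_int \<delta>) * (sg T * sg T - 4 * of_int \<delta>) =
      (of_int P * of_int P - (w * w) * (of_int Q * of_int Q))\<^sup>2
      - 8 * of_int \<delta> * (of_int P * of_int P + (w * w) * (of_int Q * of_int Q)) + 16 * (of_int \<delta> * of_int \<delta>)"
    unfolding sgT unfolding T by (simp add: power2_eq_square algebra_simps)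
  ultimately have "(of_int ((P\<^sup>2 - (s\<^sup>2 + 2) * Q\<^sup>2)\<^sup>2 - 8 * \<delta> * (P\<^sup>2 + (s\<^sup>2 + 2) * Q\<^sup>2) + 16) :: complex)
      = of_int ((s\<^sup>2 + 2) * r\<^sup>2)"
    unfolding ww_int using \<delta>(2) by (auto simp: power2_eq_square algebra_simps)
  hence eq: "(P\<^sup>2 - (s\<^sup>2 + 2) * Q\<^sup>2)\<^sup>2 - 8 * \<delta> * (P\<^sup>2 + (s\<^sup>2 + 2) * Q\<^sup>2) + 16 = (s\<^sup>2 + 2) * r\<^sup>2"
    by (simp only: of_int_eq_iff)
  have Q: "even Q" by (rule even_of_norm_equation[OF d_mod eq])
  \<comment> \<open>For Q = 0 the equation equates a square with d r^2; as \<open>d\<close> is not a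
    square, P^2 = 4 \<delta>. Then V = 0, so \<open>u\<close> equals its relative conjugate and u^2
    = 1.\<close>
  have "Q \<noteq> 0"
  proof
    assume Q0: "Q = 0"
    have "(P\<^sup>2 - 4 * \<delta>)\<^sup>2 = (s\<^sup>2 + 2) * r\<^sup>2"
      using eq \<delta>(2) unfolding Q0 by (auto simp: power2_eq_square algebra_simps)
    hence "(of_int (P\<^sup>2 - 4 * \<delta>))\<^sup>2 = d * (of_int r)\<^sup>2"
      unfolding d_eq by (metis of_int_mult of_int_power)
    hence "of_int (P\<^sup>2 - 4 * \<delta>) = (0 :: rat)" unfolding nonsquare' by blast
    hence P: "P\<^sup>2 = 4 * \<delta>" unfolding of_int_eq_0_iff by linarith
    hence "\<delta> = 1" using \<delta>(2) zero_le_power2[of P] by auto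
    have "V * V = of_int (P\<^sup>2) - 4 * of_int \<delta>" unfolding VT T Q0 by (simp add: power2_eq_square)
    hence "V = 0" unfolding P by simp
    hence "sg (sg u) = u" unfolding V_def by simp
    hence "u * u = 1" using \<delta>(1) \<open>\<delta> = 1\<close> by simp
    thus False using u(2,3) by (auto simp: square_eq_1_iff)
  qed
  hence "\<bar>Q\<bar> \<ge> 2" using Q by presburger
  hence "real_of_int \<bar>Q\<bar> \<ge> 2" by linarith
  have "T - sg T = of_int (2 * Q) * w" unfolding sgT unfolding T by (simp add: algebra_simps)
  hence "norm (T - sg T) = 2 * real_of_int \<bar>Q\<bar> * norm w" by (simp add: norm_mult)
  also have "\<dots> \<ge> 4 * norm w" using \<open>real_of_int \<bar>Q\<bar> \<ge> 2\<close> by (intro mult_right_mono) auto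
  finally have "4 * norm w \<le> norm (T - sg T)" .
  also have "\<dots> \<le> norm T + norm (sg T)" by (rule norm_triangle_ineq4)
  also have "norm T \<le> norm u + inverse (norm u)"
    unfolding T_def norm_sg2[OF u(1), symmetric] by (rule norm_triangle_ineq)
  also have "sg T = sg u + sg (sg (sg u))" unfolding T_def by (simp add: sg_add uK sg_K)
  also have "norm (sg u + sg (sg (sg u))) \<le> norm (sg u) + inverse (norm (sg u))"
    unfolding norm_sg2[OF R_sg[OF u(1)], symmetric] by (rule norm_triangle_ineq)
  finally have "4 * norm w \<le> norm u + inverse (norm u) + (norm (sg u) + inverse (norm (sg u)))" by simp
  hence "4 * norm w \<le> exp (Re (lg u)) + exp (- Re (lg u)) + exp (Im (lg u)) + exp (- Im (lg u))"
    unfolding lg_def using R_nz[OF u(1)] R_nz[OF R_sg[OF u(1)]] by (simp add: exp_minus)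
  hence "(ln (2 * \<bar>real_of_int s\<bar>))\<^sup>2 < (Re (lg u))\<^sup>2 + (Im (lg u))\<^sup>2"
    unfolding norm_w using s0 by (intro cosh_sum_bound) auto
  thus ?thesis by (simp only: cmod_power2)
qed

text \<open>Of \<open>u\<close> and its relative conjugate, one has absolute value at least 1 and
  the other at most 1; the triangle inequality bounds the larger one by the trace plus 1.\<close>

lemma abs_ln_norm_le:
  assumes "u \<in> R"
  shows "\<bar>ln (norm u)\<bar> \<le> ln (norm (u + sg (sg u)) + 1)"
proof -
  have main: "ln (norm v) \<le> ln (norm (v + v') + 1)" if "norm v * norm v' = 1" for v v' :: complex
  proof (cases "norm v \<ge> 1")
    case True
    hence "norm v' \<le> 1" using that by (metis mult_left_mono mult.right_neutral norm_ge_zero order_trans mult_right_mono mult_1)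
    moreover have "norm v \<le> norm (v + v') + norm v'" by (metis add_diff_cancel_right' norm_triangle_ineq4)
    ultimately show ?thesis using True by (subst ln_le_cancel_iff) auto
  next
    case False
    hence "ln (norm v) \<le> 0" using that by (cases "v = 0") auto
    also have "0 \<le> ln (norm (v + v') + 1)" by simp
    finally show ?thesis .
  qed
  have 1: "norm u * norm (sg (sg u)) = 1" using assms R_nz[OF assms] by (simp add: norm_sg2)
  have "ln (norm (sg (sg u))) = - ln (norm u)" using R_nz[OF assms] by (simp add: norm_sg2 assms ln_inverse)
  thus ?thesis using main[OF 1] main[of "sg (sg u)" u] 1 by (simp add: add.commute mult.commute)
qed

text \<open>The traces of \<open>\<rho>\<close> and \<open>sg \<rho>\<close> are -2 (S^2 + 1) plus
  and minus 2 m D. Increased by 1 in absolute value, one is at most 2 S^2 and the other at most 8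
  S^2, so with M = ln (2 |S|) the logarithms are at most 2 M - ln 2 and 2 M + ln 2.\<close>

lemma lg_rho_bound: "(norm (lg \<rho>))\<^sup>2 \<le> 9 * (ln (2 * \<bar>real_of_int s\<bar>))\<^sup>2"
proof -
  define S where "S = real_of_int s"
  define D where "D = sqrt (S\<^sup>2 + 2)"
  define A where "A = \<bar>real_of_int m\<bar> * D"
  have S8: "\<bar>S\<bar> \<ge> 8" using s_ge unfolding S_def by linarith
  have S64: "S * S \<ge> 64" using mult_mono[OF S8 S8] by simp
  have m2: "(real_of_int m)\<^sup>2 = 3 * S\<^sup>2 - 4 * S + 4"
    using arg_cong[OF smeq, of real_of_int] unfolding S_def by simp
  have w: "w = of_real D" unfolding w_eq D_def S_def by simp
  have A2: "A\<^sup>2 = (3 * S\<^sup>2 - 4 * S + 4) * (S\<^sup>2 + 2)"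
    unfolding A_def D_def power_mult_distrib power2_abs m2 by simp
  \<comment> \<open>After squaring this is S^4 + 4 S^3 - 14 S^2 + 8 S - 7 >= 0. From |S| >= 8 one
    gets S^2 + 4 S - 14 >= 18, also for negative S.\<close>
  have A_le: "A \<le> 2 * S\<^sup>2 - 1"
  proof (rule power2_le_imp_le)
    have "S * S + 4 * S - 14 \<ge> 18"
    proof -
      have "(\<bar>S\<bar> - 8) * (\<bar>S\<bar> + 4) \<ge> 0" using S8 by (intro mult_nonneg_nonneg) auto
      hence "\<bar>S\<bar> * \<bar>S\<bar> \<ge> 4 * \<bar>S\<bar> + 32" by (simp add: algebra_simps del: abs_mult_self_eq)
      hence "S * S \<ge> 4 * \<bar>S\<bar> + 32" by simp
      thus ?thesis by linarith
    qed
    hence "S * S * (S * S + 4 * S - 14) \<ge> S * S * 18" by (intro mult_left_mono) auto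
    moreover have "S * S * 18 + 8 * S \<ge> 7"
    proof -
      have "S * S \<ge> 8 * \<bar>S\<bar>" using mult_right_mono[OF S8, of "\<bar>S\<bar>"] by simp
      thus ?thesis using S64 by linarith
    qed
    ultimately have "S * S * (S * S + 4 * S - 14) + 8 * S - 7 \<ge> 0" by linarith
    thus "A\<^sup>2 \<le> (2 * S\<^sup>2 - 1)\<^sup>2" unfolding A2 by (simp add: power2_eq_square algebra_simps)
    show "0 \<le> 2 * S\<^sup>2 - 1" using S64 by (simp add: power2_eq_square)
  qed
  have A_ge: "A \<ge> 2"
  proof -
    have "m \<noteq> 0" using ca a0 c0 by auto
    hence "\<bar>real_of_int m\<bar> \<ge> 1" by linarith
    moreover have "D \<ge> sqrt (2\<^sup>2)" unfolding D_def using S64 by (intro real_sqrt_le_mono) (simp add: power2_eq_square)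
    hence "D \<ge> 2" by simp
    ultimately have "1 * 2 \<le> A" unfolding A_def by (intro mult_mono) auto
    thus ?thesis by simp
  qed
  have T: "\<rho> + sg (sg \<rho>) = of_real (- 2 * (S\<^sup>2 + 1) + 2 * real_of_int m * D)"
    unfolding trace_rho elt_of_int unfolding w S_def by simp
  have "sg \<rho> + sg (sg (sg \<rho>)) = sg (\<rho> + sg (sg \<rho>))" by (simp add: sg_add rho_K sg_K)
  also have "\<dots> = elt (of_int (- 2 * (s\<^sup>2 + 1))) (of_int (- (2 * m))) 0 0"
    unfolding trace_rho by simp
  also have "\<dots> = of_real (- 2 * (S\<^sup>2 + 1) - 2 * real_of_int m * D)"
    unfolding elt_of_int unfolding w S_def by simp
  finally have T': "sg \<rho> + sg (sg (sg \<rho>)) = of_real (- 2 * (S\<^sup>2 + 1) - 2 * real_of_int m * D)" .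
  define M where "M = ln (2 * \<bar>S\<bar>)"
  have M2: "ln (4 * S\<^sup>2) = 2 * M"
  proof -
    have eq: "4 * S\<^sup>2 = (2 * \<bar>S\<bar>)\<^sup>2" by (simp add: power_mult_distrib)
    show ?thesis unfolding M_def eq using S8 by (subst ln_realpow) auto
  qed
  have Sp: "S\<^sup>2 > 0" using S64 by (simp add: power2_eq_square)
  have up: "ln (t + 1) \<le> 2 * M - ln 2" if "t \<ge> 0" "t + 1 \<le> 2 * S\<^sup>2" for t
  proof -
    have "ln (t + 1) \<le> ln (4 * S\<^sup>2 / 2)" using that by (subst ln_le_cancel_iff) auto
    also have "\<dots> = 2 * M - ln 2" using Sp M2 by (subst ln_div) auto
    finally show ?thesis .
  qed
  have up': "ln (t + 1) \<le> 2 * M + ln 2" if "t \<ge> 0" "t + 1 \<le> 8 * S\<^sup>2" for t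
  proof -
    have "ln (t + 1) \<le> ln (4 * S\<^sup>2 * 2)" using that by (subst ln_le_cancel_iff) auto
    also have "\<dots> = 2 * M + ln 2" using Sp M2 by (subst ln_mult) auto
    finally show ?thesis .
  qed
  have l2: "2 * ln 2 \<le> M"
  proof -
    have "2 * ln 2 = ln (2\<^sup>2 :: real)" by (subst ln_realpow) auto
    also have "\<dots> \<le> M" unfolding M_def using S8 by (subst ln_le_cancel_iff) auto
    finally show ?thesis .
  qed
  \<comment> \<open>The sign of \<open>m\<close> is not fixed, so either conjugate may have the
    smaller trace.\<close>
  have mD: "real_of_int m * D = A \<or> real_of_int m * D = - A" unfolding A_def by (auto simp: abs_if)
  have S1: "S\<^sup>2 \<ge> 64" using S64 by (simp add: power2_eq_square)
  have small: "\<bar>- 2 * (S\<^sup>2 + 1) + 2 * A\<bar> + 1 \<le> 2 * S\<^sup>2" using A_le A_ge S1 by (simp add: abs_if)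
  have large: "\<bar>- 2 * (S\<^sup>2 + 1) - 2 * A\<bar> + 1 \<le> 8 * S\<^sup>2" using A_le A_ge S1 by (simp add: abs_if)
  have b1: "\<bar>ln (norm \<rho>)\<bar> \<le> ln (\<bar>- 2 * (S\<^sup>2 + 1) + 2 * real_of_int m * D\<bar> + 1)"
    using abs_ln_norm_le[OF rho_R] unfolding T norm_of_real .
  have b2: "\<bar>ln (norm (sg \<rho>))\<bar> \<le> ln (\<bar>- 2 * (S\<^sup>2 + 1) - 2 * real_of_int m * D\<bar> + 1)"
    using abs_ln_norm_le[OF R_sg[OF rho_R]] unfolding T' norm_of_real .
  have "\<bar>ln (norm \<rho>)\<bar> \<le> 2 * M - ln 2 \<and> \<bar>ln (norm (sg \<rho>))\<bar> \<le> 2 * M + ln 2 \<or>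
        \<bar>ln (norm \<rho>)\<bar> \<le> 2 * M + ln 2 \<and> \<bar>ln (norm (sg \<rho>))\<bar> \<le> 2 * M - ln 2"
    using mD
  proof
    assume "real_of_int m * D = A"
    hence *: "2 * real_of_int m * D = 2 * A" unfolding mult.assoc by simp
    show ?thesis using b1 b2 up[OF _ small] up'[OF _ large] unfolding * by simp
  next
    assume "real_of_int m * D = - A"
    hence *: "2 * real_of_int m * D = - (2 * A)" unfolding mult.assoc by simp
    show ?thesis using b1 b2 up[OF _ small] up'[OF _ large] unfolding * by simp
  qed
  hence "\<bar>ln (norm \<rho>)\<bar>\<^sup>2 + \<bar>ln (norm (sg \<rho>))\<bar>\<^sup>2 \<le> (2 * M - ln 2)\<^sup>2 + (2 * M + ln 2)\<^sup>2"
  proof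
    assume h: "\<bar>ln (norm \<rho>)\<bar> \<le> 2 * M - ln 2 \<and> \<bar>ln (norm (sg \<rho>))\<bar> \<le> 2 * M + ln 2"
    show ?thesis by (intro add_mono power_mono) (use h in auto)
  next
    assume h: "\<bar>ln (norm \<rho>)\<bar> \<le> 2 * M + ln 2 \<and> \<bar>ln (norm (sg \<rho>))\<bar> \<le> 2 * M - ln 2"
    have "\<bar>ln (norm \<rho>)\<bar>\<^sup>2 + \<bar>ln (norm (sg \<rho>))\<bar>\<^sup>2 \<le> (2 * M + ln 2)\<^sup>2 + (2 * M - ln 2)\<^sup>2"
      by (intro add_mono power_mono) (use h in auto)
    thus ?thesis by simp
  qed
  also have "\<dots> = 8 * M\<^sup>2 + 2 * (ln 2)\<^sup>2" by (simp add: power2_eq_square algebra_simps)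
  also have "\<dots> \<le> 8 * M\<^sup>2 + M\<^sup>2"
  proof -
    have "(2 * ln 2)\<^sup>2 \<le> M\<^sup>2" using l2 by (intro power_mono) auto
    moreover have "(2 * ln (2::real))\<^sup>2 = 4 * (ln 2)\<^sup>2" by (simp add: power_mult_distrib)
    ultimately show ?thesis using zero_le_power2[of "ln (2::real)"] by linarith
  qed
  finally show ?thesis unfolding cmod_power2 lg_def M_def S_def by simp
qed

end

section \<open>The index of the subgroup generated by the roots\<close>

text \<open>The elements \<open>r t\<close> are a transversal; cosets are compared through
  quotients.\<close>

lemma subgroup_index_eqI:
  assumes H: "1 \<in> H" "\<And>x y. x \<in> H \<Longrightarrow> y \<in> H \<Longrightarrow> x * y \<in> H" "\<And>x. x \<in> H \<Longrightarrow> inverse x \<in> H"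
    and r: "\<And>t. t < n \<Longrightarrow> r t \<in> G" and nz: "\<And>u. u \<in> G \<Longrightarrow> u \<noteq> 0"
    and cover: "\<And>u. u \<in> G \<Longrightarrow> \<exists>t<n. inverse (r t) * u \<in> H"
    and inj: "\<And>t t'. t < n \<Longrightarrow> t' < n \<Longrightarrow> inverse (r t) * r t' \<in> H \<Longrightarrow> t = t'"
  shows "subgroup_index G H = n"
proof -
  define coset where "coset = (\<lambda>u::complex. (\<lambda>h. u * h) ` H)"
  have sub: "coset u \<subseteq> coset v" if "v \<noteq> 0" "inverse v * u \<in> H" for u v
  proof
    fix x assume "x \<in> coset u"
    then obtain h where h: "h \<in> H" "x = u * h" unfolding coset_def by auto
    have "x = v * (inverse v * u * h)" using h \<open>v \<noteq> 0\<close> by simp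
    thus "x \<in> coset v" unfolding coset_def using H(2)[OF that(2) h(1)] by blast
  qed
  have eqI: "coset u = coset v" if "u \<noteq> 0" "v \<noteq> 0" "inverse v * u \<in> H" for u v
  proof
    have "inverse u * v \<in> H" using H(3)[OF that(3)] by (simp add: mult.commute)
    thus "coset v \<subseteq> coset u" using sub that by blast
  qed (use sub that in blast)
  have eqD: "inverse v * u \<in> H" if v: "v \<noteq> 0" "coset u = coset v" for u v
  proof -
    have "u * 1 \<in> coset u" unfolding coset_def using H(1) by blast
    then obtain h where "h \<in> H" "u = v * h" using v(2) unfolding coset_def by auto
    thus ?thesis using v(1) by (simp flip: mult.assoc)
  qed
  have "coset ` G = (\<lambda>t. coset (r t)) ` {..<n}"
  proof
    show "coset ` G \<subseteq> (\<lambda>t. coset (r t)) ` {..<n}"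
    proof clarify
      fix u assume u: "u \<in> G"
      then obtain t where t: "t < n" "inverse (r t) * u \<in> H" using cover by blast
      have "coset u = coset (r t)" by (rule eqI) (use t u r nz in auto)
      thus "coset u \<in> (\<lambda>t. coset (r t)) ` {..<n}" using t by blast
    qed
  qed (use r in blast)
  moreover have "inj_on (\<lambda>t. coset (r t)) {..<n}"
  proof (rule inj_onI)
    fix t t' assume t: "t \<in> {..<n}" "t' \<in> {..<n}" "coset (r t) = coset (r t')"
    hence "inverse (r t') * r t \<in> H" using r nz by (intro eqD) auto
    thus "t = t'" using inj t by fastforce
  qed
  ultimately show ?thesis
    unfolding subgroup_index_def coset_def[symmetric] by (simp add: card_image)
qed

lemma mult_subgroup_gen_inverse:
  "x \<in> mult_subgroup_gen S \<Longrightarrow> inverse x \<in> mult_subgroup_gen S"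
  by (induction rule: mult_subgroup_gen.induct)
    (auto intro: mult_subgroup_gen.intros)

lemma mult_subgroup_gen_power_int:
  assumes "x \<in> mult_subgroup_gen S"
  shows "x powi j \<in> mult_subgroup_gen S"
proof -
  have "y ^ k \<in> mult_subgroup_gen S" if "y \<in> mult_subgroup_gen S" for y k
    by (induction k) (auto intro: mult_subgroup_gen.intros that)
  thus ?thesis unfolding power_int_def using assms mult_subgroup_gen_inverse by auto
qed

lemma sum_squares_less_9:
  fixes a b :: int
  assumes "a * a + b * b < 9"
  shows "a \<in> {-2,-1,0,1,2}" "b \<in> {-2,-1,0,1,2}"
proof -
  have "\<bar>t\<bar> \<le> 2" if "t * t < 9" for t :: int
  proof (rule ccontr)
    assume "\<not> \<bar>t\<bar> \<le> 2"
    hence "3 * 3 \<le> \<bar>t\<bar> * \<bar>t\<bar>" by (intro mult_mono) auto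
    thus False using that by simp
  qed
  moreover have "a * a < 9" "b * b < 9" using assms zero_le_square[of a] zero_le_square[of b] by linarith+
  ultimately have "\<bar>a\<bar> \<le> 2" "\<bar>b\<bar> \<le> 2" by auto
  thus "a \<in> {-2,-1,0,1,2}" "b \<in> {-2,-1,0,1,2}" by auto
qed

lemma odd_sum_squares_less_9:
  fixes a b :: int
  assumes "a * a + b * b < 9" "odd (a + b)"
  shows "a * a + b * b = 1 \<or> a * a + b * b = 5"
  using sum_squares_less_9[OF assms(1)] assms by auto

text \<open>Every class \<open>p + q \<i>\<close> modulo \<open>a + b \<i>\<close> is represented by some \<open>t\<close> among 0, ..., 4;
  since \<open>a\<^sup>4 = 1\<close> modulo 5, one solves \<open>a (p - t) + b q = 0\<close> for \<open>t\<close>.\<close>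
lemma gaussian_residue_mod_5:
  fixes a b p q :: int
  assumes "a * a + b * b = 5"
  obtains t :: nat where "t < 5" "5 dvd a * (p - int t) + b * q" "5 dvd a * q - b * (p - int t)"
proof -
  have "a \<in> {-2,-1,0,1,2}" "b \<in> {-2,-1,0,1,2}" using sum_squares_less_9[of a b] assms by auto
  hence dvd: "5 dvd 1 - a * a * a * a" "5 dvd 1 + a * a * b * b" using assms by auto
  \<comment> \<open>Here a^3 is the inverse of \<open>a\<close> modulo 5. The second divisibility
    then rests on a^2 b^2 = -a^4 = -1 modulo 5.\<close>
  define t where "t = nat ((p + a * a * a * b * q) mod 5)"
  define l where "l = (p + a * a * a * b * q) div 5"
  have t: "int t = (p + a * a * a * b * q) mod 5" unfolding t_def by simp
  have pt: "p - int t = 5 * l - a * a * a * b * q"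
    unfolding t l_def by (simp add: minus_mod_eq_mult_div[symmetric] algebra_simps)
  have "a * (p - int t) + b * q = (1 - a * a * a * a) * (b * q) + 5 * (a * l)"
    unfolding pt by (simp add: algebra_simps)
  hence "5 dvd a * (p - int t) + b * q" using dvd(1) by simp
  moreover have "a * q - b * (p - int t) = (1 + a * a * b * b) * (a * q) - 5 * (b * l)"
    unfolding pt by (simp add: algebra_simps)
  hence "5 dvd a * q - b * (p - int t)" using dvd(2) by simp
  moreover have "t < 5" unfolding t_def by simp
  ultimately show ?thesis using that by blast
qed

section \<open>The subgroup generated by the roots and its index\<close>

context squarefree_family
begin

lemma log_bound_pos: "(ln (2 * \<bar>real_of_int s\<bar>))\<^sup>2 > 0"
proof -
  have "2 * \<bar>real_of_int s\<bar> > 1" using s_ge by linarith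
  thus ?thesis by simp
qed

lemmas lg_cong = lg_eq_iff[OF log_bound_pos lg_bound]

definition H :: "complex set" where "H = mult_subgroup_gen ({1, -1} \<union> F_roots s)"

lemma H_1: "1 \<in> H" and H_m1: "-1 \<in> H" and H_eps: "\<epsilon> \<in> H" and H_sg_eps: "sg \<epsilon> \<in> H"
  and H_sg2_eps: "sg (sg \<epsilon>) \<in> H"
  unfolding H_def F_roots_eq by (auto intro: mult_subgroup_gen.intros)

lemma H_mult: "x \<in> H \<Longrightarrow> y \<in> H \<Longrightarrow> x * y \<in> H"
  unfolding H_def by (rule mult_subgroup_gen.mult)

lemma H_inverse: "x \<in> H \<Longrightarrow> inverse x \<in> H"
  unfolding H_def by (rule mult_subgroup_gen_inverse)

lemma H_power_int: "x \<in> H \<Longrightarrow> x powi j \<in> H"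
  unfolding H_def by (rule mult_subgroup_gen_power_int)

lemma H_minus: "x \<in> H \<Longrightarrow> - x \<in> H"
  using H_mult[OF H_m1, of x] by simp

lemma H_rho: "\<rho> \<in> H"
  unfolding \<rho>_def by (intro H_mult H_eps H_sg_eps)

lemma H_sg_rho: "sg \<rho> \<in> H"
  unfolding \<rho>_def by (simp add: sg_mult eps_K sg_K H_mult H_sg_eps H_sg2_eps)

lemma m1_U: "-1 \<in> U"
  using U_minus[OF U_1] .

lemma H_subset_U: "H \<subseteq> U"
proof
  fix x assume "x \<in> H"
  thus "x \<in> U" unfolding H_def F_roots_eq
    by (induction rule: mult_subgroup_gen.induct)
      (auto intro!: U_1 m1_U U_inverse sg_U eps_U intro: U_mult)
qed

lemma R_in_H: "v \<in> R \<Longrightarrow> lg v = Complex (of_int x) (of_int y) * lg \<rho> \<Longrightarrow> v \<in> H"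
proof -
  assume v: "v \<in> R" "lg v = Complex (of_int x) (of_int y) * lg \<rho>"
  have "v = \<rho> powi x * sg \<rho> powi (- y) \<or> v = - (\<rho> powi x * sg \<rho> powi (- y))"
    by (rule lg_cong) (use v rho_R in \<open>auto simp: lg_combination intro: combination_R\<close>)
  moreover have "\<rho> powi x * sg \<rho> powi (- y) \<in> H" by (intro H_mult H_power_int H_rho H_sg_rho)
  ultimately show ?thesis using H_minus by blast
qed

text \<open>The absolute value of \<open>\<nu>\<close> is \<open>pell_unit s\<close>, a positive
  real other than 1.\<close>

lemma nu_power_int:
  assumes "\<nu> powi j = 1 \<or> \<nu> powi j = -1"
  shows "j = 0"
proof -
  have pos: "pell_unit s > 0 \<and> pell_unit s \<noteq> 1"
  proof (cases "s > 0")
    case True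
    thus ?thesis using pell_unit_gt_1[of s] by simp
  next
    case False
    hence "pell_unit (- s) > 1" using s0 by (intro pell_unit_gt_1) simp
    thus ?thesis by (simp add: pell_unit_minus one_less_inverse_iff)
  qed
  have "norm (\<nu> powi j) = 1" using assms by auto
  hence "pell_unit s powi j = 1" using pos by (simp add: norm_power_int nu_eq)
  hence "pell_unit s powr (of_int j) = 1" using pos by (simp add: powr_real_of_int')
  thus ?thesis using pos by simp
qed

text \<open>Up to sign, every element of \<open>H\<close> is \<open>\<epsilon>\<^sup>j\<close> times an element of the \<open>\<int>[\<sigma>]\<close>-module generated by \<open>\<rho>\<close>;
  for relative units \<open>j = 0\<close> by comparing relative norms.\<close>
lemma H_cases:
  assumes "h \<in> H"
  obtains j v x y where "v \<in> R" "h = \<epsilon> powi j * v" "lg v = Complex (of_int x) (of_int y) * lg \<rho>"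
proof -
  define P where "P h \<longleftrightarrow> (\<exists>j v x y. v \<in> R \<and> h = \<epsilon> powi j * v \<and> lg v = Complex (of_int x) (of_int y) * lg \<rho>)" for h
  have nz: "\<epsilon> \<noteq> 0" "\<rho> \<noteq> 0" using U_nz[OF eps_U] R_nz[OF rho_R] by auto
  have P_mult: "P (h * k)" if hk: "P h" "P k" for h k
  proof -
    obtain j v x y where 1: "v \<in> R" "h = \<epsilon> powi j * v" "lg v = Complex (of_int x) (of_int y) * lg \<rho>"
      using hk(1) unfolding P_def by blast
    obtain j' v' x' y' where 2: "v' \<in> R" "k = \<epsilon> powi j' * v'" "lg v' = Complex (of_int x') (of_int y') * lg \<rho>"
      using hk(2) unfolding P_def by blast
    have "lg (v * v') = Complex (of_int (x + x')) (of_int (y + y')) * lg \<rho>"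
      using 1 2 by (simp add: lg_mult R_U) (simp add: complex_eq_iff algebra_simps)
    moreover have "h * k = \<epsilon> powi (j + j') * (v * v')" using 1 2 nz by (simp add: power_int_add mult_ac)
    ultimately show ?thesis unfolding P_def using R_mult[OF 1(1) 2(1)] by blast
  qed
  have P_inv: "P (inverse h)" if Ph: "P h" for h
  proof -
    obtain j v x y where 1: "v \<in> R" "h = \<epsilon> powi j * v" "lg v = Complex (of_int x) (of_int y) * lg \<rho>"
      using Ph unfolding P_def by blast
    have "lg (inverse v) = Complex (of_int (- x)) (of_int (- y)) * lg \<rho>"
      using 1 by (simp add: lg_inverse R_U) (simp add: complex_eq_iff algebra_simps)
    moreover have "inverse h = \<epsilon> powi (- j) * inverse v" using 1 nz by (simp add: power_int_minus)
    ultimately show ?thesis unfolding P_def using R_inverse[OF 1(1)] by blast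
  qed
  have PR: "P v" if "v \<in> R" "lg v = Complex (of_int x) (of_int y) * lg \<rho>" for v x y
    unfolding P_def using that by (intro exI[of _ 0] exI[of _ v] exI[of _ x] exI[of _ y]) simp
  have P1: "P 1" by (rule PR[of _ 0 0]) (auto simp: R_1 lg_1 complex_eq_iff)
  have Pm1: "P (-1)"
  proof (rule PR[of _ 0 0])
    have "sg (- 1) = - 1" using sg_of_int[of "-1"] by simp
    thus "lg (- 1) = Complex (of_int 0) (of_int 0) * lg \<rho>" by (simp add: lg_def) (simp add: complex_eq_iff)
  qed (rule R_minus[OF R_1])
  have Pe: "P \<epsilon>" unfolding P_def
    by (intro exI[of _ 1] exI[of _ "1::complex"] exI[of _ 0]) (auto simp: R_1 lg_1 complex_eq_iff)
  have Pr: "P \<rho>" by (rule PR[of _ 1 0]) (auto simp: rho_R complex_eq_iff)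
  have Psr: "P (sg \<rho>)" by (rule PR[of _ 0 "-1"]) (auto simp: R_sg rho_R lg_sg complex_eq_iff)
  \<comment> \<open>The remaining roots come from \<open>\<epsilon>\<close>, \<open>\<rho>\<close>
    and \<open>sg \<rho>\<close> by products and inverses, the last one because the four roots
    multiply to 1.\<close>
  have "sg \<epsilon> = \<rho> * inverse \<epsilon>" unfolding \<rho>_def using nz by simp
  hence Pe1: "P (sg \<epsilon>)" using P_mult[OF Pr P_inv[OF Pe]] by simp
  have sgnz: "sg \<epsilon> \<noteq> 0" "sg (sg \<epsilon>) \<noteq> 0" using nz by (auto simp: sg_eq_0_iff eps_K sg_K)
  have "sg (sg \<epsilon>) = sg \<rho> * inverse (sg \<epsilon>)" unfolding \<rho>_def using sgnz by (simp add: sg_mult eps_K sg_K)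
  hence Pe2: "P (sg (sg \<epsilon>))" using P_mult[OF Psr P_inv[OF Pe1]] by simp
  have "(\<epsilon> * sg \<epsilon> * sg (sg \<epsilon>)) * sg (sg (sg \<epsilon>)) = 1"
    using nu_mult_sg_nu unfolding \<nu>_def by (simp add: sg_mult eps_K sg_K mult_ac)
  hence "inverse (\<epsilon> * sg \<epsilon> * sg (sg \<epsilon>)) = sg (sg (sg \<epsilon>))" by (rule inverse_unique)
  hence Pe3: "P (sg (sg (sg \<epsilon>)))" using P_inv[OF P_mult[OF P_mult[OF Pe Pe1] Pe2]] by simp
  have "P h" using assms unfolding H_def F_roots_eq
  proof (induction rule: mult_subgroup_gen.induct)
    case (gen x) thus ?case using P1 Pm1 Pe Pe1 Pe2 Pe3 by auto
  next
    case (inv x) thus ?case using P_inv P1 Pm1 Pe Pe1 Pe2 Pe3 by auto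
  qed (auto intro: P1 P_mult)
  thus ?thesis using that unfolding P_def by blast
qed

lemma R_H_cases:
  assumes "u \<in> R" "u \<in> H"
  obtains x y where "lg u = Complex (of_int x) (of_int y) * lg \<rho>"
proof -
  obtain j v x y where 1: "v \<in> R" "u = \<epsilon> powi j * v" "lg v = Complex (of_int x) (of_int y) * lg \<rho>"
    using assms(2) by (rule H_cases)
  have "\<epsilon> powi j = u * inverse v" using 1 R_nz by simp
  hence R: "\<epsilon> powi j \<in> R" using R_mult[OF assms(1) R_inverse[OF 1(1)]] by simp
  have "\<epsilon> powi j * sg (sg (\<epsilon> powi j)) = \<nu> powi j"
    unfolding \<nu>_def by (simp add: sg_power_int eps_K sg_K power_int_mult_distrib)
  hence "\<nu> powi j = 1 \<or> \<nu> powi j = -1" using R unfolding R_def by auto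
  hence "j = 0" by (rule nu_power_int)
  hence "lg u = Complex (of_int x) (of_int y) * lg \<rho>" using 1 by simp
  thus ?thesis by (rule that)
qed

text \<open>If \<open>\<rho> = \<epsilon> \<sigma>(\<epsilon>)\<close> were \<open>\<plusminus>v \<sigma>(v)\<close> with \<open>v\<close> a relative unit, then \<open>\<epsilon>/v\<close> would be a unit of the quadratic
  subfield, so the relative norm \<open>\<nu>\<close> of \<open>\<epsilon>\<close> would be a square up to sign.\<close>
lemma rho_not_mult_sg:
  assumes v: "v \<in> R"
  shows "lg \<rho> \<noteq> lg v + lg (sg v)"
proof
  assume "lg \<rho> = lg v + lg (sg v)"
  hence "lg \<rho> = lg (v * sg v)" using v by (simp add: lg_mult R_U R_sg)
  hence rho: "\<rho> = v * sg v \<or> \<rho> = - (v * sg v)"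
    by (intro lg_cong) (use v rho_R in \<open>auto intro: R_mult R_sg\<close>)
  define t where "t = \<epsilon> * inverse v"
  have tU: "t \<in> U" unfolding t_def by (intro U_mult U_inverse eps_U R_U v)
  have vnz: "v \<noteq> 0" "sg v \<noteq> 0" using R_nz[OF v] R_nz[OF R_sg[OF v]] by auto
  have "sg t = sg \<epsilon> * inverse (sg v)"
    unfolding t_def using v by (simp add: sg_mult eps_K K_inverse R_K sg_inverse)
  hence "t * sg t * (v * sg v) = \<rho>" unfolding t_def \<rho>_def using vnz by (simp add: field_simps)
  hence "t * sg t * (v * sg v) = 1 * (v * sg v) \<or> t * sg t * (v * sg v) = (-1) * (v * sg v)"
    using rho by auto
  hence t: "t * sg t = 1 \<or> t * sg t = -1" unfolding mult_cancel_right using vnz by simp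
  have tnz: "t \<noteq> 0" "sg t \<noteq> 0" using U_nz[OF tU] U_nz[OF sg_U[OF tU]] by auto
  \<comment> \<open>Applying \<open>sg\<close> to t sg(t) = 1 or -1 and cancelling
    \<open>sg t\<close> shows that \<open>t\<close> is fixed by the square of \<open>sg\<close>,
    hence lies in Q(w).\<close>
  have "sg t * sg (sg t) = t * sg t"
  proof -
    have "sg (- 1) = - 1" using sg_of_int[of "-1"] by simp
    hence "sg (t * sg t) = t * sg t" using t by auto
    thus ?thesis by (simp add: sg_mult U_K[OF tU] sg_K)
  qed
  hence sg2: "sg (sg t) = t" using tnz by (simp add: mult.commute)
  obtain x0 x1 x2 x3 where x: "t = elt x0 x1 x2 x3" using U_K[OF tU] by (rule K_cases)
  have "x2 = 0" "x3 = 0" using sg2 unfolding x by (auto simp: elt_inject)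
  hence tk: "t = elt x0 x1 0 0" using x by simp
  obtain j where j: "t = \<nu> powi j \<or> t = - (\<nu> powi j)" using unit_quadratic[of x0 x1] tU unfolding tk by blast
  have nnz: "\<nu> \<noteq> 0" using nu_mult_sg_nu by auto
  have eps: "\<epsilon> = t * v" unfolding t_def using vnz by simp
  have "\<nu> = (t * t) * (v * sg (sg v))"
    unfolding \<nu>_def eps using sg2 v tU by (simp add: sg_mult U_K R_K sg_K mult_ac)
  moreover have "\<nu> powi (2 * j) = \<nu> powi j * \<nu> powi j"
    unfolding mult_2 by (rule power_int_add) (use nnz in simp)
  hence "t * t = \<nu> powi (2 * j)" using j by (metis minus_mult_minus)
  ultimately have "\<nu> = \<nu> powi (2 * j) * (v * sg (sg v))" by (simp only:)
  hence "\<nu> = \<nu> powi (2 * j) \<or> \<nu> = - (\<nu> powi (2 * j))" using v unfolding R_def by force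
  hence "\<nu> powi (2 * j) = \<nu> \<or> \<nu> powi (2 * j) = - \<nu>" by (metis minus_minus)
  hence "\<nu> powi (2 * j) * \<nu> powi (-1) = 1 \<or> \<nu> powi (2 * j) * \<nu> powi (-1) = -1"
    using nnz by (elim disjE) (simp_all add: power_int_minus)
  \<comment> \<open>The exponent is odd, so it cannot be 0.\<close>
  hence "\<nu> powi (2 * j + (-1)) = 1 \<or> \<nu> powi (2 * j + (-1)) = -1"
    using nnz by (subst (1 2) power_int_add) auto
  hence "2 * j + (-1) = 0" by (rule nu_power_int)
  thus False by presburger
qed

lemma unit_index: "H = U \<or> subgroup_index U H = 5"
proof -
  obtain \<mu> where \<mu>: "\<mu> \<in> R" "(norm (lg \<mu>))\<^sup>2 > (ln (2 * \<bar>real_of_int s\<bar>))\<^sup>2"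
    "\<And>u. u \<in> R \<Longrightarrow> \<exists>p q. lg u = Complex (of_int p) (of_int q) * lg \<mu>"
    using R_generator[OF log_bound_pos lg_bound rho_R rho_ne] by blast
  obtain a b where ab: "lg \<rho> = Complex (of_int a) (of_int b) * lg \<mu>" using \<mu>(3)[OF rho_R] by blast
  have \<mu>nz: "lg \<mu> \<noteq> 0" using \<mu>(2) log_bound_pos by auto
  \<comment> \<open>The norm of a + b i is the squared ratio of |lg \<rho>| to |lg \<mu>|, which the
    two bounds keep below 9.\<close>
  have "real_of_int (a * a + b * b) * (norm (lg \<mu>))\<^sup>2 = (norm (lg \<rho>))\<^sup>2"
    unfolding ab norm_mult power_mult_distrib cmod_power2 by (simp add: power2_eq_square)
  also have "\<dots> \<le> 9 * (ln (2 * \<bar>real_of_int s\<bar>))\<^sup>2" by (rule lg_rho_bound)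
  also have "\<dots> < 9 * (norm (lg \<mu>))\<^sup>2" using \<mu>(2) by simp
  finally have "real_of_int (a * a + b * b) < 9" using \<mu>nz by (simp add: mult_less_cancel_right)
  hence less: "a * a + b * b < 9" by linarith
  have "odd (a + b)"
  proof
    assume "even (a + b)"
    then obtain k where k: "a + b = 2 * k" by blast
    \<comment> \<open>For even a + b, the factorisation a + b i = (1 - i) ((a - k) + k i) gives lg
      \<rho> = lg v + lg (sg v).\<close>
    define v where "v = \<mu> powi (a - k) * sg \<mu> powi (- k)"
    have v: "v \<in> R" unfolding v_def by (rule combination_R[OF \<mu>(1)])
    have "lg v = Complex (of_int (a - k)) (of_int k) * lg \<mu>"
      unfolding v_def by (rule lg_combination[OF \<mu>(1)])
    moreover have b: "b = 2 * k - a" using k by simp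
    ultimately have "lg v + lg (sg v) = lg \<rho>"
      unfolding lg_sg[OF v] ab b by (simp add: complex_eq_iff algebra_simps)
    thus False using rho_not_mult_sg[OF v] by simp
  qed
  from odd_sum_squares_less_9[OF less this] have n15: "a * a + b * b = 1 \<or> a * a + b * b = 5" .
  define n where "n = a * a + b * b"
  have n0: "n \<noteq> 0" using n15 unfolding n_def by auto
  \<comment> \<open>The two expressions are the real and imaginary parts of (a - b i)(p + q i).
    Their divisibility by the norm \<open>n\<close> means that a + b i divides p + q i, so that lg v
    is a Gaussian multiple of lg \<rho>.\<close>
  have inH: "v \<in> H" if v: "v \<in> R" "lg v = Complex (of_int p) (of_int q) * lg \<mu>"
    and dvd: "n dvd a * p + b * q" "n dvd a * q - b * p" for v p q
  proof -
    obtain x y where xy: "a * p + b * q = n * x" "a * q - b * p = n * y" using dvd unfolding dvd_def by auto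
    have "n * p = n * (a * x - b * y)" "n * q = n * (a * y + b * x)"
      using arg_cong[OF xy(1), of "\<lambda>t. a * t"] arg_cong[OF xy(2), of "\<lambda>t. b * t"]
        arg_cong[OF xy(1), of "\<lambda>t. b * t"] arg_cong[OF xy(2), of "\<lambda>t. a * t"]
      unfolding n_def by (simp_all add: algebra_simps)
    hence pq: "p = a * x - b * y" "q = a * y + b * x" using n0 by simp_all
    have "lg v = Complex (of_int x) (of_int y) * lg \<rho>"
      unfolding v(2) ab pq by (simp add: complex_eq_iff algebra_simps)
    thus ?thesis by (rule R_in_H[OF v(1)])
  qed
  have red: "inverse z * u \<in> H" if u: "u = \<epsilon> powi j * v" and vz: "inverse z * v \<in> H" for z u v j
  proof -
    have "inverse z * u = \<epsilon> powi j * (inverse z * v)" unfolding u by (simp add: mult_ac)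
    thus ?thesis using H_mult[OF H_power_int[OF H_eps] vz] by (simp only:)
  qed
  show ?thesis using n15
  proof
    assume "a * a + b * b = 1"
    hence n1: "n = 1" unfolding n_def .
    have "U \<subseteq> H"
    proof
      fix u assume "u \<in> U"
      then obtain j v where jv: "v \<in> R" "u = \<epsilon> powi j * v" by (rule unit_decomposition)
      obtain p q where pq: "lg v = Complex (of_int p) (of_int q) * lg \<mu>" using \<mu>(3)[OF jv(1)] by blast
      have "v \<in> H" by (rule inH[OF jv(1) pq]) (simp_all add: n1)
      thus "u \<in> H" using red[OF jv(2), of 1] by simp
    qed
    thus ?thesis using H_subset_U by blast
  next
    assume n5: "a * a + b * b = 5"
    hence n: "n = 5" unfolding n_def .
    have "subgroup_index U H = 5"
    \<comment> \<open>Modulo \<epsilon> and signs, the cosets correspond to Gaussian integers modulo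
      a + b i, a residue field of 5 elements represented by 0, ..., 4.\<close>
    proof (rule subgroup_index_eqI[where r = "\<lambda>t. \<mu> powi int t"])
      show "\<mu> powi int t \<in> U" for t by (intro U_power_int R_U \<mu>(1))
      show "\<exists>t<5. inverse (\<mu> powi int t) * u \<in> H" if u: "u \<in> U" for u
      proof -
        obtain j v where jv: "v \<in> R" "u = \<epsilon> powi j * v" using u by (rule unit_decomposition)
        obtain p q where pq: "lg v = Complex (of_int p) (of_int q) * lg \<mu>" using \<mu>(3)[OF jv(1)] by blast
        obtain t :: nat where t: "t < 5" "5 dvd a * (p - int t) + b * q" "5 dvd a * q - b * (p - int t)"
          using gaussian_residue_mod_5[OF n5] by blast
        have "inverse (\<mu> powi int t) * v \<in> H"
        proof (rule inH)
          show "inverse (\<mu> powi int t) * v \<in> R" by (intro R_mult R_inverse R_power_int \<mu>(1) jv(1))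
          have "lg (inverse (\<mu> powi int t) * v) = lg v - of_int (int t) * lg \<mu>"
            using jv(1) \<mu>(1) by (simp only: lg_mult lg_inverse lg_power_int U_inverse U_power_int R_U) simp
          thus "lg (inverse (\<mu> powi int t) * v) = Complex (of_int (p - int t)) (of_int q) * lg \<mu>"
            unfolding pq by (simp add: complex_eq_iff algebra_simps)
        qed (use t n in auto)
        thus ?thesis using red[OF jv(2)] t(1) by blast
      qed
      show "t = t'" if "t < 5" "t' < 5" and tt: "inverse (\<mu> powi int t) * \<mu> powi int t' \<in> H" for t t' :: nat
      proof -
        let ?u = "inverse (\<mu> powi int t) * \<mu> powi int t'"
        have "?u \<in> R" by (intro R_mult R_inverse R_power_int \<mu>(1))
        then obtain x y where xy: "lg ?u = Complex (of_int x) (of_int y) * lg \<rho>"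
          using tt by (rule R_H_cases)
        have "lg ?u = of_int (int t' - int t) * lg \<mu>"
          using \<mu>(1) by (simp only: lg_mult lg_inverse lg_power_int U_inverse U_power_int R_U) (simp add: algebra_simps)
        hence "of_int (int t' - int t) * lg \<mu> = Complex (of_int x) (of_int y) * Complex (of_int a) (of_int b) * lg \<mu>"
          using xy unfolding ab by (simp add: mult.assoc)
        hence "of_int (int t' - int t) = Complex (of_int x) (of_int y) * Complex (of_int a) (of_int b)"
          using \<mu>nz by simp
        hence "real_of_int (int t' - int t) = real_of_int (x * a - y * b)" "real_of_int (x * b + y * a) = 0"
          by (simp_all add: complex_eq_iff)
        hence 1: "int t' - int t = x * a - y * b" "x * b + y * a = 0" by (simp_all only: of_int_eq_iff of_int_eq_0_iff)
        \<comment> \<open>Taking norms in t' - t = (x + y i)(a + b i), whose right side has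
          imaginary part 0.\<close>
        have "(int t' - int t) * (int t' - int t) = (x * a - y * b) * (x * a - y * b) + (x * b + y * a) * (x * b + y * a)"
          unfolding 1 by simp
        also have "\<dots> = 5 * (x * x + y * y)" unfolding n5[symmetric] by (simp add: algebra_simps)
        finally have "5 dvd (int t' - int t) * (int t' - int t)" by simp
        hence "5 dvd int t' - int t" by (simp add: prime_dvd_mult_iff)
        thus "t = t'" using that(1,2) by presburger
      qed
    qed (auto simp: H_1 H_mult H_inverse U_nz)
    thus ?thesis by blast
  qed
qed

end

theorem theorem1:
  fixes s :: int
  assumes "\<exists>m::int. 3*s^2 - 4*s + 4 = m^2"
  shows "cyclic_of_order 4 (galois_group (splitting_field (F_poly s))) \<and>
         (squarefree (s^2 + 2) \<and> s \<noteq> 0 \<longrightarrow>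
            (let K = splitting_field (F_poly s);
                 H = mult_subgroup_gen ({1, -1} \<union> F_roots s)
             in H = unit_group K \<or> (H \<subseteq> unit_group K \<and> subgroup_index (unit_group K) H = 5)))"
proof -
  obtain m where "3*s^2 - 4*s + 4 = m^2" using assms by blast
  then obtain a b c d w e f where "quartic_family a b c d w e f s m"
    by (rule quartic_family_exists)
  then interpret quartic_family a b c d w e f s m .
  show ?thesis
  proof (intro conjI impI)
    show "cyclic_of_order 4 (galois_group (splitting_field (F_poly s)))"
      unfolding splitting_field_eq by (rule cyclic_galois_group)
  next
    assume "squarefree (s^2 + 2) \<and> s \<noteq> 0"
    then interpret squarefree_family a b c d w e f s m by unfold_locales auto
    show "let K = splitting_field (F_poly s); H = mult_subgroup_gen ({1, -1} \<union> F_roots s)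
        in H = unit_group K \<or> (H \<subseteq> unit_group K \<and> subgroup_index (unit_group K) H = 5)"
      unfolding Let_def splitting_field_eq H_def[symmetric] U_def[symmetric]
      using unit_index H_subset_U by blast
  qed
qed

end
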